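(* For $w=w_1w_2\cdots w_n\in B_n$, the following statements are equivalent: (1) $w$ is a separable signed permutation. (2) There exist $p\in[n-1]$ and separable signed permutations $u\in B_p$, $v\in B_{n-p}$ such that either $w=u\oplus v$ or $w=u\ominus v$. (3) There exists a unique sequence $0=p_0<p_1<p_2<\cdots<p_k<p_{k+1}=n$ such that $$w=w_1\cdots w_{p_1}\oplus \mathrm{sts}(w_{p_1+1}\cdots w_{p_2})\oplus\cdots\oplus \mathrm{sts}(w_{p_k+1}\cdots w_n),$$ where $w_1\cdots w_{p_1}$ and $\mathrm{sts}(w_{p_i+1}\cdots w_{p_{i+1}})$ for $i\in[k]$ are separable, and for each $i\in[k]$, the consecutive blocks $w_{p_{i-1}+1}\cdots w_{p_i}$ and $w_{p_i+1}\cdots w_{p_{i+1}}$ have entries of opposite signs. (4) $w$ can be built from $1$ and $\bar 1$ by repeated applications of the operations $\oplus$ and $\ominus$.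
   Context: Notation: $[n]=\{1,\dots,n\}$ and $\bar a=-a$. $B_n$ is the hyperoctahedral group of signed permutations: bijections $w$ of $\{\pm1,\dots,\pm n\}$ with $w(-i)=-w(i)$, written in one-line notation $w=w_1\cdots w_n$ with $w_i=w(i)$ for $i\in[n]$. In particular $1$ and $\bar 1$ are the two elements of $B_1$. For a word $a=a_1\cdots a_m$ of nonzero integers, its standardized signed permutation $\mathrm{sts}(a)$ is the signed permutation $x\in B_m$ such that $x_i<0$ if and only if $a_i<0$, and for all $1\le i<j\le m$, $|x_i|<|x_j|$ if and only if $|a_i|\le|a_j|$. A signed permutation $w\in B_n$ contains the pattern $u\in B_m$ ($m\le n$) if $\mathrm{sts}(w_{i_1}\cdots w_{i_m})=u$ for some $1\le i_1<\cdots<i_m\le n$; otherwise $w$ avoids $u$. Separable: $w\in B_n$ is separable if and only if it avoids the six patterns $\bar21$, $2\bar1$, $3142$, $2413$, $\bar3\,\bar1\,\bar4\,\bar2$, $\bar2\,\bar4\,\bar1\,\bar3$. Direct sum: for $u\in B_p$, $v\in B_q$, $u\oplus v\in B_{p+q}$ is given by $(u\oplus v)_i=u_i$ for $1\le i\le p$ and $(u\oplus v)_i=v_{i-p}+(\mathrm{sgn}\,v_{i-p})\,p$ for $p+1\le i\le p+q$, where $\mathrm{sgn}\,x=1$ if $x>0$ and $-1$ if $x<0$. Skew sum: $u\ominus v\in B_{p+q}$ is defined only when all entries of $u$ and $v$ have the same sign (that is, $\mathrm{sgn}\,u_i=\mathrm{sgn}\,v_j$ for all $i\in[p]$, $j\in[q]$);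 in that case $(u\ominus v)_i=u_i+(\mathrm{sgn}\,u_i)\,q$ for $1\le i\le p$ and $(u\ominus v)_i=v_{i-p}$ for $p+1\le i\le p+q$.
   Formalization: Equivalence with (2) is stated only for n ≥ 2, since for n = 1 the set [n−1] is empty and (2) fails though w is separable; in (3) each block must also have entries of one sign, since for k = 0 the sign condition is void and uniqueness would fail (e.g. w = 1 followed by −2). *)

theory Defs
  imports "HOL-Combinatorics.Permutations" "HOL-Library.Sublist"
begin

text \<open>Signed permutations are represented by their one-line notation
  \<open>w\<^sub>1\<dots>w\<^sub>n\<close>, an integer list. List positions count from 0, so \<open>w\<^sub>i\<close> is \<open>w ! (i - 1)\<close>.\<close>

definition signed_perms :: "nat \<Rightarrow> int list set" where
  "signed_perms n =
     {map f [1..int n] | f. f permutes {i. 1 \<le> \<bar>i\<bar> \<and> \<bar>i\<bar> \<le> int n} \<and> (\<forall>i. f (- i) = - f i)}"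

definition sts :: "int list \<Rightarrow> int list" where
  "sts a = (THE x. x \<in> signed_perms (length a) \<and>
     (\<forall>i<length a. x ! i < 0 \<longleftrightarrow> a ! i < 0) \<and>
     (\<forall>j<length a. \<forall>i<j. \<bar>x ! i\<bar> < \<bar>x ! j\<bar> \<longleftrightarrow> \<bar>a ! i\<bar> \<le> \<bar>a ! j\<bar>))"

definition contains_pattern :: "int list \<Rightarrow> int list \<Rightarrow> bool" where
  "contains_pattern w u \<longleftrightarrow> (\<exists>a. subseq a w \<and> length a = length u \<and> sts a = u)"

definition separable :: "nat \<Rightarrow> int list \<Rightarrow> bool" where
  "separable n w \<longleftrightarrow> w \<in> signed_perms n \<and>
     (\<forall>u \<in> {[-2, 1], [2, -1], [3, 1, 4, 2], [2, 4, 1, 3], [-3, -1, -4, -2], [-2, -4, -1, -3]}.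
        \<not> contains_pattern w u)"

definition direct_sum :: "int list \<Rightarrow> int list \<Rightarrow> int list"  (infixl "\<oplus>" 65) where
  "u \<oplus> v = u @ map (\<lambda>x. x + sgn x * int (length u)) v"

definition same_signs :: "int list \<Rightarrow> int list \<Rightarrow> bool" where
  "same_signs u v \<longleftrightarrow> (\<forall>x \<in> set u. \<forall>y \<in> set v. sgn x = sgn y)"

definition opposite_signs :: "int list \<Rightarrow> int list \<Rightarrow> bool" where
  "opposite_signs u v \<longleftrightarrow> (\<forall>x \<in> set u. \<forall>y \<in> set v. sgn x = - sgn y)"

text \<open>The skew sum is a partial operation: \<open>u \<ominus> v\<close> is meaningful only under
  \<open>same_signs u v\<close> (for nonempty \<open>u\<close> and \<open>v\<close>, all entries of both have one common sign),
  and every use of it below and in the theorem carries this side condition.\<close>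

definition skew_sum :: "int list \<Rightarrow> int list \<Rightarrow> int list"  (infixl "\<ominus>" 65) where
  "u \<ominus> v = map (\<lambda>x. x + sgn x * int (length v)) u @ v"

inductive_set sum_generated :: "int list set" where
  one: "[1] \<in> sum_generated"
| minus_one: "[-1] \<in> sum_generated"
| direct: "u \<in> sum_generated \<Longrightarrow> v \<in> sum_generated \<Longrightarrow> u \<oplus> v \<in> sum_generated"
| skew: "u \<in> sum_generated \<Longrightarrow> v \<in> sum_generated \<Longrightarrow> same_signs u v \<Longrightarrow> u \<ominus> v \<in> sum_generated"

text \<open>For cut points \<open>p = [p\<^sub>0, \<dots>, p\<^sub>k\<^sub>+\<^sub>1]\<close>, \<open>block w p i\<close> is the consecutive subword of \<open>w\<close>
  at positions \<open>p\<^sub>i + 1, \<dots>, p\<^sub>i\<^sub>+\<^sub>1\<close>, counted from 1.\<close>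

definition block :: "int list \<Rightarrow> nat list \<Rightarrow> nat \<Rightarrow> int list" where
  "block w p i = drop (p ! i) (take (p ! (i + 1)) w)"

text \<open>That the entries of each block share one sign already follows from the condition on
  consecutive blocks when \<open>k \<ge> 1\<close>. It is stated separately because that condition is void
  for \<open>k = 0\<close>; without it the trivial sequence \<open>[0, n]\<close> would be admissible for every
  separable \<open>w\<close>, and uniqueness would fail for every separable \<open>w\<close> of mixed signs.\<close>

definition sign_block_decomposition :: "nat \<Rightarrow> int list \<Rightarrow> nat list \<Rightarrow> bool" where
  "sign_block_decomposition n w p \<longleftrightarrow> (\<exists>k.
     length p = k + 2 \<and> p ! 0 = 0 \<and> p ! (k + 1) = n \<and> (\<forall>i\<le>k. p ! i < p ! (i + 1)) \<and>
     w = foldl (\<oplus>) (block w p 0) (map (\<lambda>i. sts (block w p i)) [1..<k + 1]) \<and>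
     separable (p ! 1) (block w p 0) \<and>
     (\<forall>i\<in>{1..k}. separable (p ! (i + 1) - p ! i) (sts (block w p i))) \<and>
     (\<forall>i\<le>k. same_signs (block w p i) (block w p i)) \<and>
     (\<forall>i\<in>{1..k}. opposite_signs (block w p (i - 1)) (block w p i)))"

end

theory Submission
  imports Defs
begin

text \<open>An inversion of the absolute values of a separable word \<open>w\<close> joins entries of equal
  sign, and \<open>\<bar>w\<bar>\<close> avoids 2413 and 3142. Such a word of length at least 2 is cut by some position
  into two parts one of which lies below the other in absolute value: cut the word without its
  last entry \<open>x\<close>, say into \<open>A < B\<close> (the other case is dual). If \<open>x\<close> lies strictly inside the range
  of \<open>A\<close>, cut the shorter word \<open>A x\<close>; a cut of \<open>A x\<close> into a lower and an upper part extends by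
  \<open>B\<close>, and the opposite kind of cut exhibits a 3142 that ends in \<open>b x\<close> with \<open>b\<close> in \<open>B\<close>. Cuts of the
  two kinds are direct and skew sums, as cut entries of opposite signs never form an inversion.
  The blocks of a decomposition as in (3) are forced to be the maximal runs of constant sign.\<close>

subsection \<open>Signed permutations and standardization\<close>

text \<open>List form of a signed permutation, on which the later arguments rest. From left to
  right, oddness of \<open>f\<close> moves a preimage to a positive argument. From right to left,
  the odd extension of \<open>w\<close> maps a finite symmetric set onto itself and is therefore
  injective on it.\<close>

lemma signed_perms_iff:
  "w \<in> signed_perms n \<longleftrightarrow> length w = n \<and> abs ` set w = {1..int n}"
proof
  assume "w \<in> signed_perms n"
  then obtain f where w: "w = map f [1..int n]"
    and f: "f permutes {i. 1 \<le> \<bar>i\<bar> \<and> \<bar>i\<bar> \<le> int n}" and odd: "\<And>i. f (- i) = - f i"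
    unfolding signed_perms_def by auto
  have "y \<in> abs ` f ` {1..int n}" if y: "y \<in> {1..int n}" for y
  proof -
    from f have "y \<in> f ` {i. 1 \<le> \<bar>i\<bar> \<and> \<bar>i\<bar> \<le> int n}"
      using y by (simp add: permutes_image)
    then obtain x where x: "1 \<le> \<bar>x\<bar>" "\<bar>x\<bar> \<le> int n" "y = f x" by auto
    have "\<bar>f \<bar>x\<bar>\<bar> = y" using x odd[of x] y by (auto simp: abs_if)
    moreover have "\<bar>x\<bar> \<in> {1..int n}" using x by simp
    ultimately show ?thesis by (metis imageI)
  qed
  moreover have "\<bar>f x\<bar> \<in> {1..int n}" if "x \<in> {1..int n}" for x
    using permutes_in_image[OF f, of x] that by auto
  ultimately show "length w = n \<and> abs ` set w = {1..int n}"
    by (auto simp: w image_subset_iff)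
next
  assume w: "length w = n \<and> abs ` set w = {1..int n}"
  define S where "S = {i. 1 \<le> \<bar>i\<bar> \<and> \<bar>i\<bar> \<le> int n}"
  \<comment> \<open>The odd extension of the one-line notation. The position is
    \<open>nat \<bar>i\<bar> - 1\<close> because lists count from 0; off \<open>S\<close>, in
    particular at 0, \<open>f\<close> is the identity, as \<open>permutes\<close> demands.\<close>
  define f where "f i = (if i \<in> S then sgn i * w ! (nat \<bar>i\<bar> - 1) else i)" for i
  have "S \<subseteq> {- int n..int n}" by (auto simp: S_def)
  then have fin: "finite S" by (rule finite_subset) simp
  have sub: "f i \<in> S" if "i \<in> S" for i
  proof -
    have "w ! (nat \<bar>i\<bar> - 1) \<in> set w" using w that by (intro nth_mem) (auto simp: S_def)
    then have "\<bar>w ! (nat \<bar>i\<bar> - 1)\<bar> \<in> {1..int n}" using w by blast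
    then show ?thesis using that by (auto simp: f_def S_def abs_mult)
  qed
  have sur: "y \<in> f ` S" if y: "y \<in> S" for y
  proof -
    have "\<bar>y\<bar> \<in> abs ` set w" using w y by (auto simp: S_def)
    then obtain z where "z \<in> set w" "\<bar>y\<bar> = \<bar>z\<bar>" by blast
    then obtain j where j: "j < n" "\<bar>y\<bar> = \<bar>w ! j\<bar>" using w by (auto simp: in_set_conv_nth)
    \<comment> \<open>Up to sign the preimage must be position \<open>j\<close> counted from 1; the
      sign is chosen so that \<open>f i\<close> is \<open>y\<close> and not
      \<open>- y\<close>.\<close>
    define i where "i = (if y = w ! j then int (Suc j) else - int (Suc j))"
    have "i \<in> S" using j by (auto simp: S_def i_def)
    moreover have "\<bar>i\<bar> = int (Suc j)" by (simp add: i_def)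
    then have "nat \<bar>i\<bar> - 1 = j" by simp
    moreover have "sgn i * w ! j = y" using j(2) by (auto simp: i_def abs_eq_iff)
    ultimately show ?thesis by (auto simp: f_def intro!: image_eqI[of y f i])
  qed
  have im: "f ` S = S" using sub sur by blast
  then have "inj_on f S" using fin by (simp add: eq_card_imp_inj_on)
  with im have "f permutes S"
    by (intro bij_imp_permutes) (auto simp: bij_betw_def f_def)
  moreover have "f (- i) = - f i" for i
    by (auto simp: f_def S_def)
  moreover have "w = map f [1..int n]"
    using w by (intro nth_equalityI) (auto simp: f_def S_def nat_add_distrib)
  ultimately show "w \<in> signed_perms n"
    unfolding signed_perms_def S_def by blast
qed

lemma signed_perms_length: "w \<in> signed_perms n \<Longrightarrow> length w = n"
  by (simp add: signed_perms_iff)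

lemma signed_perms_nonzero: "w \<in> signed_perms n \<Longrightarrow> 0 \<notin> set w"
  unfolding signed_perms_iff by force

lemma signed_perms_distinct:
  assumes "w \<in> signed_perms n" shows "distinct (map abs w)"
  using assms by (intro card_distinct) (simp add: signed_perms_iff)

text \<open>The position \<open>i\<close> itself is counted, so ranks start at 1, like the absolute
  values of a signed permutation.\<close>

definition abs_rank :: "int list \<Rightarrow> nat \<Rightarrow> nat" where
  "abs_rank a i = card {j. j < length a \<and> \<bar>a ! j\<bar> \<le> \<bar>a ! i\<bar>}"

definition standardize :: "int list \<Rightarrow> int list" where
  "standardize a = map (\<lambda>i. sgn (a ! i) * int (abs_rank a i)) [0..<length a]"

text \<open>The condition under the definite description in \<open>sts\<close>, kept in the same
  form so that it can be folded into \<open>sts_def\<close>. Its mixture of < and \<le> breaks ties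
  from left to right; for distinct absolute values it says that both words are ordered
  alike.\<close>

definition sts_spec :: "int list \<Rightarrow> int list \<Rightarrow> bool" where
  "sts_spec a x \<longleftrightarrow> x \<in> signed_perms (length a) \<and>
     (\<forall>i<length a. x ! i < 0 \<longleftrightarrow> a ! i < 0) \<and>
     (\<forall>j<length a. \<forall>i<j. \<bar>x ! i\<bar> < \<bar>x ! j\<bar> \<longleftrightarrow> \<bar>a ! i\<bar> \<le> \<bar>a ! j\<bar>)"

lemma abs_rank_less:
  assumes "i < length a" "j < length a" "\<bar>a ! i\<bar> < \<bar>a ! j\<bar>"
  shows "abs_rank a i < abs_rank a j"
  unfolding abs_rank_def
proof (intro psubset_card_mono psubsetI)
  show "{k. k < length a \<and> \<bar>a ! k\<bar> \<le> \<bar>a ! i\<bar>} \<subseteq> {k. k < length a \<and> \<bar>a ! k\<bar> \<le> \<bar>a ! j\<bar>}"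
    using assms(3) by fastforce
  have "j \<in> {k. k < length a \<and> \<bar>a ! k\<bar> \<le> \<bar>a ! j\<bar>}" "j \<notin> {k. k < length a \<and> \<bar>a ! k\<bar> \<le> \<bar>a ! i\<bar>}"
    using assms by simp_all
  then show "{k. k < length a \<and> \<bar>a ! k\<bar> \<le> \<bar>a ! i\<bar>} \<noteq> {k. k < length a \<and> \<bar>a ! k\<bar> \<le> \<bar>a ! j\<bar>}"
    by blast
qed simp

lemma abs_rank_less_iff:
  assumes "i < length a" "j < length a" "distinct (map abs a)"
  shows "abs_rank a i < abs_rank a j \<longleftrightarrow> \<bar>a ! i\<bar> < \<bar>a ! j\<bar>"
proof (cases "i = j")
  case False
  then have "\<bar>a ! i\<bar> \<noteq> \<bar>a ! j\<bar>" using assms by (auto simp: distinct_conv_nth)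
  then show ?thesis using abs_rank_less[of i a j] abs_rank_less[of j a i] assms by linarith
qed simp

lemma abs_rank_bounds:
  assumes "i < length a" shows "abs_rank a i \<in> {1..length a}"
proof -
  have "i \<in> {j. j < length a \<and> \<bar>a ! j\<bar> \<le> \<bar>a ! i\<bar>}" using assms by simp
  then have "abs_rank a i > 0" unfolding abs_rank_def by (subst card_gt_0_iff) auto
  moreover have "abs_rank a i \<le> card {..<length a}"
    unfolding abs_rank_def by (rule card_mono) auto
  ultimately show ?thesis by simp
qed

text \<open>Distinct absolute values have distinct ranks, so the ranks are as many different numbers
  in \<open>{1..length a}\<close> as there are positions and exhaust this interval. Nonzero entries
  are needed for \<open>sgn\<close> to keep the rank as absolute value.\<close>

lemma sts_spec_standardize:
  assumes "distinct (map abs a)" "0 \<notin> set a"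
  shows "sts_spec a (standardize a)"
proof -
  let ?m = "length a"
  have nz: "a ! i \<noteq> 0" if "i < ?m" for i using assms(2) that by (metis nth_mem)
  have ab: "\<bar>standardize a ! i\<bar> = int (abs_rank a i)" if "i < ?m" for i
    using nz[OF that] that by (simp add: standardize_def abs_mult)
  have ne: "\<bar>a ! i\<bar> \<noteq> \<bar>a ! j\<bar>" if "i < j" "j < ?m" for i j
    using assms(1) that by (auto simp: distinct_conv_nth)
  have "inj_on (abs_rank a) {..<?m}"
  proof (rule inj_onI)
    fix i j assume ij: "i \<in> {..<?m}" "j \<in> {..<?m}" "abs_rank a i = abs_rank a j"
    then have "\<bar>a ! i\<bar> = \<bar>a ! j\<bar>"
      using abs_rank_less[of i a j] abs_rank_less[of j a i] by fastforce
    then show "i = j" using ne[of i j] ne[of j i] ij by (cases i j rule: linorder_cases) auto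
  qed
  then have "card (abs_rank a ` {..<?m}) = card {1..?m}" by (simp add: card_image)
  then have "abs_rank a ` {..<?m} = {1..?m}"
    using abs_rank_bounds by (intro card_subset_eq) auto
  then have "int ` abs_rank a ` {..<?m} = {1..int ?m}"
    by (simp add: image_int_atLeastAtMost)
  moreover have "abs ` set (standardize a) = int ` abs_rank a ` {..<?m}"
    unfolding standardize_def image_image set_map set_upt
    by (rule image_cong) (use nz in \<open>auto simp: abs_mult\<close>)
  ultimately have perm: "standardize a \<in> signed_perms ?m"
    by (simp add: signed_perms_iff standardize_def)
  have "standardize a ! i < 0 \<longleftrightarrow> a ! i < 0" if "i < ?m" for i
    using that abs_rank_bounds[OF that] by (auto simp: standardize_def mult_less_0_iff)
  moreover have "\<bar>standardize a ! i\<bar> < \<bar>standardize a ! j\<bar> \<longleftrightarrow> \<bar>a ! i\<bar> \<le> \<bar>a ! j\<bar>"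
    if "i < j" "j < ?m" for i j
    using that ab ne[OF that] abs_rank_less_iff[OF _ _ assms(1), of i j] by auto
  ultimately show ?thesis using perm by (auto simp: sts_spec_def)
qed

text \<open>Each number from 1 to the absolute value of \<open>x ! i\<close> occurs exactly once
  among the absolute values of \<open>x\<close>, so counting them returns that value.\<close>

lemma abs_rank_signed_perm:
  assumes "x \<in> signed_perms n" "i < n"
  shows "int (abs_rank x i) = \<bar>x ! i\<bar>"
proof -
  have len: "length x = n" and im: "abs ` set x = {1..int n}"
    using assms by (auto simp: signed_perms_iff)
  have inj: "inj_on (\<lambda>j. \<bar>x ! j\<bar>) {..<n}"
    using signed_perms_distinct[OF assms(1)] len by (auto simp: inj_on_def distinct_conv_nth)
  have "(\<lambda>j. \<bar>x ! j\<bar>) ` {..<n} = {1..int n}"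
    unfolding im[symmetric] using len by (auto simp: set_conv_nth)
  then have mem: "\<And>y. y \<in> {1..int n} \<longleftrightarrow> (\<exists>j<n. y = \<bar>x ! j\<bar>)" by (auto simp: image_iff set_eq_iff)
  have "(\<lambda>j. \<bar>x ! j\<bar>) ` {j. j < n \<and> \<bar>x ! j\<bar> \<le> \<bar>x ! i\<bar>} = {1..\<bar>x ! i\<bar>}"
  proof (intro equalityI subsetI)
    fix y assume "y \<in> {1..\<bar>x ! i\<bar>}"
    moreover from this have "y \<in> {1..int n}" using mem[of "\<bar>x ! i\<bar>"] assms(2) by auto
    ultimately show "y \<in> (\<lambda>j. \<bar>x ! j\<bar>) ` {j. j < n \<and> \<bar>x ! j\<bar> \<le> \<bar>x ! i\<bar>}"
      using mem[of y] by auto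
  next
    fix y assume "y \<in> (\<lambda>j. \<bar>x ! j\<bar>) ` {j. j < n \<and> \<bar>x ! j\<bar> \<le> \<bar>x ! i\<bar>}"
    then show "y \<in> {1..\<bar>x ! i\<bar>}" using mem[of y] by auto
  qed
  then have "card {j. j < n \<and> \<bar>x ! j\<bar> \<le> \<bar>x ! i\<bar>} = card {1..\<bar>x ! i\<bar>}"
    using card_image[OF inj_on_subset[OF inj], of "{j. j < n \<and> \<bar>x ! j\<bar> \<le> \<bar>x ! i\<bar>}"]
    by (metis (no_types, lifting) lessThan_iff mem_Collect_eq subsetI)
  then show ?thesis by (simp add: abs_rank_def len)
qed

text \<open>The specification fixes how the absolute values of \<open>x\<close> compare, hence their
  ranks; in a signed permutation rank and absolute value coincide, and the signs are those of
  \<open>a\<close>.\<close>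

lemma standardize_unique:
  assumes "sts_spec a x" "distinct (map abs a)" "0 \<notin> set a"
  shows "x = standardize a"
proof (rule nth_equalityI)
  have x: "x \<in> signed_perms (length a)" using assms(1) by (simp add: sts_spec_def)
  then have len: "length x = length a" by (rule signed_perms_length)
  then show "length x = length (standardize a)" by (simp add: standardize_def)
  fix i assume "i < length x"
  then have i: "i < length a" by (simp add: len)
  have "\<bar>x ! j\<bar> \<le> \<bar>x ! i\<bar> \<longleftrightarrow> \<bar>a ! j\<bar> \<le> \<bar>a ! i\<bar>" if "j < length a" for j
  proof -
    have "j \<noteq> i \<Longrightarrow> \<bar>x ! j\<bar> \<noteq> \<bar>x ! i\<bar>" "j \<noteq> i \<Longrightarrow> \<bar>a ! j\<bar> \<noteq> \<bar>a ! i\<bar>"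
      using assms(2) signed_perms_distinct[OF x] i that len by (auto simp: distinct_conv_nth)
    moreover have "j < i \<Longrightarrow> \<bar>x ! j\<bar> < \<bar>x ! i\<bar> \<longleftrightarrow> \<bar>a ! j\<bar> \<le> \<bar>a ! i\<bar>"
      "i < j \<Longrightarrow> \<bar>x ! i\<bar> < \<bar>x ! j\<bar> \<longleftrightarrow> \<bar>a ! i\<bar> \<le> \<bar>a ! j\<bar>"
      using assms(1) i that by (auto simp: sts_spec_def)
    ultimately show ?thesis by (cases i j rule: linorder_cases) auto
  qed
  then have "{j. j < length a \<and> \<bar>a ! j\<bar> \<le> \<bar>a ! i\<bar>} = {j. j < length a \<and> \<bar>x ! j\<bar> \<le> \<bar>x ! i\<bar>}"
    by auto
  then have "abs_rank a i = abs_rank x i"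
    by (simp add: abs_rank_def len)
  then have "int (abs_rank a i) = \<bar>x ! i\<bar>" using abs_rank_signed_perm[OF x i] by simp
  moreover have "x ! i < 0 \<longleftrightarrow> a ! i < 0"
    using assms(1) i by (simp add: sts_spec_def)
  moreover have "a ! i \<in> set a" "x ! i \<in> set x" using i len by auto
  then have "a ! i \<noteq> 0" "x ! i \<noteq> 0" using assms(3) signed_perms_nonzero[OF x] by metis+
  ultimately have "sgn (a ! i) = sgn (x ! i)"
    by (auto simp: sgn_if)
  with \<open>int (abs_rank a i) = \<bar>x ! i\<bar>\<close> show "x ! i = standardize a ! i"
    using i by (simp add: standardize_def sgn_mult_abs)
qed

text \<open>Removes the definite description: from here on only \<open>sts_spec\<close> is
  used.\<close>

lemma sts_eq_iff:
  assumes "distinct (map abs a)" "0 \<notin> set a"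
  shows "sts a = x \<longleftrightarrow> sts_spec a x"
proof -
  have "sts_spec a y \<longleftrightarrow> y = standardize a" for y
    using sts_spec_standardize standardize_unique assms by blast
  moreover from this have "sts a = standardize a"
    unfolding sts_def sts_spec_def[symmetric] by (simp only: the_eq_trivial)
  ultimately show ?thesis by auto
qed

subsection \<open>Avoidance of 2413 and 3142\<close>

text \<open>With respect to the converse relation this is avoidance of 3142.\<close>

definition avoids_2413 :: "('a \<Rightarrow> 'a \<Rightarrow> bool) \<Rightarrow> 'a list \<Rightarrow> bool" where
  "avoids_2413 R xs \<longleftrightarrow>
     (\<forall>a b c d. subseq [a, b, c, d] xs \<longrightarrow> \<not> (R c a \<and> R a d \<and> R d b))"

text \<open>For comparison of absolute values this is a cut of direct sum type, and for the converse
  relation one of skew sum type; keeping \<open>R\<close> abstract lets one argument serve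
  both.\<close>

definition splits :: "('a \<Rightarrow> 'a \<Rightarrow> bool) \<Rightarrow> 'a list \<Rightarrow> bool" where
  "splits R xs \<longleftrightarrow>
     (\<exists>as bs. xs = as @ bs \<and> as \<noteq> [] \<and> bs \<noteq> [] \<and> (\<forall>a\<in>set as. \<forall>b\<in>set bs. R a b))"

lemma splitsI:
  "xs = as @ bs \<Longrightarrow> as \<noteq> [] \<Longrightarrow> bs \<noteq> [] \<Longrightarrow> (\<And>a b. a \<in> set as \<Longrightarrow> b \<in> set bs \<Longrightarrow> R a b)
    \<Longrightarrow> splits R xs"
  unfolding splits_def by blast

lemma subseq_set_subset: "subseq xs ys \<Longrightarrow> set xs \<subseteq> set ys"
  by (metis notin_set_nthsI subseq_conv_nths subsetI)

lemma avoids_2413_subseq: "avoids_2413 R xs \<Longrightarrow> subseq ys xs \<Longrightarrow> avoids_2413 R ys"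
  unfolding avoids_2413_def by (meson subseq_order.trans)

text \<open>The step of the induction in \<open>avoids_splits\<close>, separated so that it can be
  applied both to \<open>R\<close> and to its converse. \<open>IH\<close> is the induction
  hypothesis, symmetric in the two kinds of cut.\<close>

lemma splits_snoc:
  assumes tr: "transp R" and asm: "asymp R" and tot: "totalp_on (set (ys @ [x])) R" and dist: "distinct (ys @ [x])"
    and av: "avoids_2413 R\<inverse>\<inverse> (ys @ [x])" and sp: "splits R ys"
    and IH: "\<And>zs. subseq zs (ys @ [x]) \<Longrightarrow> length zs < length (ys @ [x]) \<Longrightarrow> 2 \<le> length zs
               \<Longrightarrow> splits R zs \<or> splits R\<inverse>\<inverse> zs"
  shows "splits R (ys @ [x]) \<or> splits R\<inverse>\<inverse> (ys @ [x])"
proof -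
  obtain as bs where ys: "ys = as @ bs" "as \<noteq> []" "bs \<noteq> []"
    and lt: "\<And>a b. a \<in> set as \<Longrightarrow> b \<in> set bs \<Longrightarrow> R a b"
    using sp unfolding splits_def by blast
  have cmp: "R x y \<or> R y x" if "y \<in> set ys" for y
    using tot dist that unfolding totalp_on_def by auto
  consider (above) "\<And>a. a \<in> set as \<Longrightarrow> R a x" | (below) "\<And>y. y \<in> set ys \<Longrightarrow> R x y"
    | (mid) a c where "a \<in> set as" "R x a" "c \<in> set ys" "R c x"
    using cmp ys(1) by auto
  then show ?thesis
  proof cases
    case above
    then have "splits R (ys @ [x])"
      using ys lt by (intro splitsI[of _ as "bs @ [x]"]) auto
    then show ?thesis ..
  next
    case below
    then have "splits R\<inverse>\<inverse> (ys @ [x])"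
      using ys by (intro splitsI[of _ ys "[x]"]) auto
    then show ?thesis ..
  next
    case mid
    \<comment> \<open>Everything in \<open>bs\<close> lies above \<open>a\<close> and thus above
      \<open>x\<close>, whereas \<open>c\<close> lies below \<open>x\<close>.\<close>
    have "c \<notin> set bs"
    proof
      assume "c \<in> set bs"
      then have "R a c" using lt mid(1) by blast
      then have "R x c" using tr mid(2) by (blast dest: transpD)
      then show False using asm mid(4) by (blast dest: asympD)
    qed
    then have c: "c \<in> set as" using mid(3) ys(1) by simp
    have "subseq (as @ [x]) (ys @ [x])" unfolding ys(1) subseq_append by auto
    then consider "splits R (as @ [x])" | "splits R\<inverse>\<inverse> (as @ [x])"
      using IH[of "as @ [x]"] ys by (cases as; cases bs) auto
    then show ?thesis
    proof cases
      case 1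
      then obtain ps qs where pq: "as @ [x] = ps @ qs" "ps \<noteq> []" "qs \<noteq> []"
        and less: "\<And>p q. p \<in> set ps \<Longrightarrow> q \<in> set qs \<Longrightarrow> R p q"
        unfolding splits_def by blast
      obtain rs where rs: "qs = rs @ [x]" "as = ps @ rs"
        using pq by (cases qs rule: rev_cases) auto
      \<comment> \<open>The part \<open>ps\<close> is below \<open>rs\<close> and \<open>x\<close>
        by the cut of \<open>as @ [x]\<close>, and below \<open>bs\<close> because it belongs to
        \<open>as\<close>.\<close>
      have "splits R (ys @ [x])"
        using ys rs pq less lt by (intro splitsI[of _ ps "rs @ bs @ [x]"]) auto
      then show ?thesis ..
    next
      case 2
      then obtain ps qs where pq: "as @ [x] = ps @ qs" "ps \<noteq> []" "qs \<noteq> []"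
        and less: "\<And>p q. p \<in> set ps \<Longrightarrow> q \<in> set qs \<Longrightarrow> R q p"
        unfolding splits_def by blast
      obtain rs where rs: "qs = rs @ [x]" "as = ps @ rs"
        using pq by (cases qs rule: rev_cases) auto
      have "c \<notin> set ps" using less[of c x] rs(1) mid(4) asm by (auto dest: asympD)
      then have "c \<in> set rs" using c rs(2) by simp
      moreover obtain p b where pb: "p \<in> set ps" "b \<in> set bs"
        using pq(2) ys(3) by (meson last_in_set)
      \<comment> \<open>In the order \<open>R\<close> the entries satisfy
        \<open>c < x < p < b\<close>, so this is an occurrence of 3142.\<close>
      ultimately have "subseq ([p] @ [c] @ [b] @ [x]) (ps @ rs @ bs @ [x])"
        by (intro list_emb_append_mono) (auto simp: subseq_singleton_left)
      then have "subseq [p, c, b, x] (ys @ [x])" using ys(1) rs(2) by simp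
      moreover have "R x p" using less pb(1) rs(1) by simp
      moreover have "R p b" using lt pb rs(2) by simp
      ultimately have False using av mid(4) unfolding avoids_2413_def by blast
      then show ?thesis ..
    qed
  qed
qed

lemma avoids_splits:
  assumes "transp R" "asymp R" "totalp_on (set xs) R" "distinct xs"
    and "avoids_2413 R xs" "avoids_2413 R\<inverse>\<inverse> xs" "2 \<le> length xs"
  shows "splits R xs \<or> splits R\<inverse>\<inverse> xs"
  using assms(3-)
proof (induction "length xs" arbitrary: xs rule: less_induct)
  case less
  have IH: "splits R zs \<or> splits R\<inverse>\<inverse> zs"
    if "subseq zs xs" "length zs < length xs" "2 \<le> length zs" for zs
  proof (rule less.hyps)
    have "set zs \<subseteq> set xs" using that(1) by (rule subseq_set_subset)
    then show "totalp_on (set zs) R" using less.prems(1) by (rule totalp_on_subset[rotated])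
    show "distinct zs" using that(1) less.prems(2) by (auto simp: subseq_conv_nths)
  qed (use that less.prems avoids_2413_subseq in blast)+
  obtain ys x where xs: "xs = ys @ [x]"
    using less.prems(5) by (cases xs rule: rev_cases) auto
  show ?case
  \<comment> \<open>A word of length 2 is treated apart: its prefix is too short to have a
    cut.\<close>
  proof (cases "length ys = 1")
    case True
    then obtain y where "ys = [y]" by (metis One_nat_def Suc_length_conv length_0_conv)
    moreover from this have "R x y \<or> R y x"
      using less.prems(1,2) unfolding totalp_on_def xs by auto
    ultimately show ?thesis
      using xs splitsI[of xs "[y]" "[x]" R] splitsI[of xs "[y]" "[x]" "R\<inverse>\<inverse>"] by auto
  next
    case False
    then have "splits R ys \<or> splits R\<inverse>\<inverse> ys"
      using less.prems(5) by (intro IH) (auto simp: xs)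
    then show ?thesis
    proof
      assume "splits R ys"
      then show ?thesis
        using splits_snoc[of R ys x] assms(1,2) less.prems IH unfolding xs by blast
    next
      assume "splits R\<inverse>\<inverse> ys"
      \<comment> \<open>The hypotheses are symmetric under passing to the converse, which exchanges
        2413 with 3142 and the two kinds of cut.\<close>
      moreover have "transp R\<inverse>\<inverse>" "asymp R\<inverse>\<inverse>" "totalp_on (set xs) R\<inverse>\<inverse>"
        using assms(1,2) less.prems(1) by (auto simp: totalp_on_def)
      ultimately show ?thesis
        using splits_snoc[of "R\<inverse>\<inverse>" ys x] less.prems IH unfolding xs by auto
    qed
  qed
qed

text \<open>However 2413 is cut into two nonempty parts, some pair across the cut ascends and
  another descends. All pairs across the boundary of \<open>xs\<close> and \<open>ys\<close> compare
  in one direction, so no occurrence can straddle it.\<close>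

lemma avoids_2413_append:
  assumes "asymp R" "avoids_2413 R xs" "avoids_2413 R ys"
    and "(\<forall>x\<in>set xs. \<forall>y\<in>set ys. R x y) \<or> (\<forall>x\<in>set xs. \<forall>y\<in>set ys. R y x)"
  shows "avoids_2413 R (xs @ ys)"
  unfolding avoids_2413_def
proof (intro allI impI notI)
  fix a b c d assume "subseq [a, b, c, d] (xs @ ys)" and R: "R c a \<and> R a d \<and> R d b"
  then obtain us vs where uv: "[a, b, c, d] = us @ vs" "subseq us xs" "subseq vs ys"
    by (elim subseq_appendE)
  have sub: "set us \<subseteq> set xs" "set vs \<subseteq> set ys"
    using uv(2,3) by (simp_all add: subseq_set_subset)
  have asym: "R x y \<Longrightarrow> \<not> R y x" for x y using assms(1) by (rule asympD)
  consider "vs = []" | "us = []" | "us = [a]" "vs = [b, c, d]" | "us = [a, b]" "vs = [c, d]"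
    | "us = [a, b, c]" "vs = [d]"
    using uv(1) by (auto simp: Cons_eq_append_conv)
  then show False
  proof cases
    case 1
    then have "subseq [a, b, c, d] xs" using uv by simp
    then show False using assms(2) R unfolding avoids_2413_def by blast
  next
    case 2
    then have "subseq [a, b, c, d] ys" using uv by simp
    then show False using assms(3) R unfolding avoids_2413_def by blast
  next
    case 3
    then have "R a c \<or> R d a" using assms(4) sub by auto
    then show False using R asym by blast
  next
    case 4
    then have "R a c \<or> R d a" using assms(4) sub by auto
    then show False using R asym by blast
  next
    case 5
    then have "R b d \<or> R d a" using assms(4) sub by auto
    then show False using R asym by blast
  qed
qed

lemma avoids_2413_map:
  assumes "\<And>x y. x \<in> set xs \<Longrightarrow> y \<in> set xs \<Longrightarrow> R' (f x) (f y) \<longleftrightarrow> R x y"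
  shows "avoids_2413 R' (map f xs) \<longleftrightarrow> avoids_2413 R xs"
proof
  assume av: "avoids_2413 R' (map f xs)"
  show "avoids_2413 R xs"
    unfolding avoids_2413_def
  proof (intro allI impI)
    fix a b c d assume sub: "subseq [a, b, c, d] xs"
    then have "subseq [f a, f b, f c, f d] (map f xs)" using subseq_map by fastforce
    then have "\<not> (R' (f c) (f a) \<and> R' (f a) (f d) \<and> R' (f d) (f b))"
      using av unfolding avoids_2413_def by blast
    then show "\<not> (R c a \<and> R a d \<and> R d b)"
      using assms subseq_set_subset[OF sub] by simp
  qed
next
  assume av: "avoids_2413 R xs"
  show "avoids_2413 R' (map f xs)"
    unfolding avoids_2413_def
  proof (intro allI impI)
    fix a b c d assume "subseq [a, b, c, d] (map f xs)"
    then obtain zs where sub: "subseq zs xs" and zs: "[a, b, c, d] = map f zs"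
      by (metis nths_map subseq_conv_nths)
    then obtain a' b' c' d' where z: "zs = [a', b', c', d']" "a = f a'" "b = f b'" "c = f c'" "d = f d'"
      by (auto simp: Cons_eq_map_conv eq_commute[of "map f zs"])
    then have "\<not> (R c' a' \<and> R a' d' \<and> R d' b')"
      using av sub unfolding avoids_2413_def by blast
    then show "\<not> (R' c a \<and> R' a d \<and> R' d b)"
      using assms subseq_set_subset[OF sub] z by simp
  qed
qed

subsection \<open>Separability of words\<close>

definition abs_less :: "int \<Rightarrow> int \<Rightarrow> bool" where
  "abs_less x y \<longleftrightarrow> \<bar>x\<bar> < \<bar>y\<bar>"

lemma abs_less_order: "transp abs_less" "asymp abs_less"
  by (auto simp: abs_less_def intro!: transpI asympI)

text \<open>The inversion graphs of 2413 and 3142 are connected, so once inverted pairs have equal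
  signs, only the absolute values matter in the four patterns of length 4.\<close>

definition separable_word :: "int list \<Rightarrow> bool" where
  "separable_word w \<longleftrightarrow>
     (\<forall>a b. subseq [a, b] w \<longrightarrow> \<bar>b\<bar> < \<bar>a\<bar> \<longrightarrow> sgn a = sgn b) \<and>
     avoids_2413 abs_less w \<and> avoids_2413 abs_less\<inverse>\<inverse> w"

text \<open>Supplies the hypotheses of \<open>sts_eq_iff\<close> for every subword of a signed
  permutation.\<close>

lemma subseq_signed_perm:
  assumes "w \<in> signed_perms n" "subseq a w"
  shows "distinct (map abs a)" "0 \<notin> set a"
  using signed_perms_distinct[OF assms(1)] signed_perms_nonzero[OF assms(1)]
    subseq_map[OF assms(2), of abs] subseq_set_subset[OF assms(2)]
  by (auto simp: subseq_conv_nths)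

lemma contains_pattern_iff:
  assumes "w \<in> signed_perms n"
  shows "contains_pattern w u \<longleftrightarrow> (\<exists>a. subseq a w \<and> length a = length u \<and> sts_spec a u)"
  using sts_eq_iff subseq_signed_perm[OF assms] unfolding contains_pattern_def by blast

text \<open>Reduces containment to signs and strict comparisons, which simplification evaluates once
  the pattern is concrete. Distinct absolute values turn the \<le> of the specification into
  <.\<close>

lemma contains_pattern_2:
  assumes "w \<in> signed_perms n" "[x, y] \<in> signed_perms 2"
  shows "contains_pattern w [x, y] \<longleftrightarrow>
    (\<exists>a b. subseq [a, b] w \<and> (x < 0 \<longleftrightarrow> a < 0) \<and> (y < 0 \<longleftrightarrow> b < 0) \<and> (\<bar>x\<bar> < \<bar>y\<bar> \<longleftrightarrow> \<bar>a\<bar> < \<bar>b\<bar>))"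
proof -
  have "sts_spec [a, b] [x, y] \<longleftrightarrow>
      (x < 0 \<longleftrightarrow> a < 0) \<and> (y < 0 \<longleftrightarrow> b < 0) \<and> (\<bar>x\<bar> < \<bar>y\<bar> \<longleftrightarrow> \<bar>a\<bar> < \<bar>b\<bar>)"
    if "subseq [a, b] w" for a b
    using assms(2) subseq_signed_perm(1)[OF assms(1) that]
    by (simp add: sts_spec_def eval_nat_numeral All_less_Suc2 conj_ac order.order_iff_strict)
  moreover have "(\<exists>a. subseq a w \<and> length a = length [x, y] \<and> sts_spec a [x, y]) \<longleftrightarrow>
    (\<exists>a b. subseq [a, b] w \<and> sts_spec [a, b] [x, y])"
    by (auto simp: length_Suc_conv)
  ultimately show ?thesis unfolding contains_pattern_iff[OF assms(1)] by (simp cong: conj_cong)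
qed

lemma contains_pattern_4:
  assumes "w \<in> signed_perms n" "[x, y, z, t] \<in> signed_perms 4"
  shows "contains_pattern w [x, y, z, t] \<longleftrightarrow>
    (\<exists>a b c d. subseq [a, b, c, d] w \<and>
       (x < 0 \<longleftrightarrow> a < 0) \<and> (y < 0 \<longleftrightarrow> b < 0) \<and> (z < 0 \<longleftrightarrow> c < 0) \<and> (t < 0 \<longleftrightarrow> d < 0) \<and>
       (\<bar>x\<bar> < \<bar>y\<bar> \<longleftrightarrow> \<bar>a\<bar> < \<bar>b\<bar>) \<and> (\<bar>x\<bar> < \<bar>z\<bar> \<longleftrightarrow> \<bar>a\<bar> < \<bar>c\<bar>) \<and> (\<bar>x\<bar> < \<bar>t\<bar> \<longleftrightarrow> \<bar>a\<bar> < \<bar>d\<bar>) \<and>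
       (\<bar>y\<bar> < \<bar>z\<bar> \<longleftrightarrow> \<bar>b\<bar> < \<bar>c\<bar>) \<and> (\<bar>y\<bar> < \<bar>t\<bar> \<longleftrightarrow> \<bar>b\<bar> < \<bar>d\<bar>) \<and> (\<bar>z\<bar> < \<bar>t\<bar> \<longleftrightarrow> \<bar>c\<bar> < \<bar>d\<bar>))"
proof -
  have "sts_spec [a, b, c, d] [x, y, z, t] \<longleftrightarrow>
       (x < 0 \<longleftrightarrow> a < 0) \<and> (y < 0 \<longleftrightarrow> b < 0) \<and> (z < 0 \<longleftrightarrow> c < 0) \<and> (t < 0 \<longleftrightarrow> d < 0) \<and>
       (\<bar>x\<bar> < \<bar>y\<bar> \<longleftrightarrow> \<bar>a\<bar> < \<bar>b\<bar>) \<and> (\<bar>x\<bar> < \<bar>z\<bar> \<longleftrightarrow> \<bar>a\<bar> < \<bar>c\<bar>) \<and> (\<bar>x\<bar> < \<bar>t\<bar> \<longleftrightarrow> \<bar>a\<bar> < \<bar>d\<bar>) \<and>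
       (\<bar>y\<bar> < \<bar>z\<bar> \<longleftrightarrow> \<bar>b\<bar> < \<bar>c\<bar>) \<and> (\<bar>y\<bar> < \<bar>t\<bar> \<longleftrightarrow> \<bar>b\<bar> < \<bar>d\<bar>) \<and> (\<bar>z\<bar> < \<bar>t\<bar> \<longleftrightarrow> \<bar>c\<bar> < \<bar>d\<bar>)"
    if "subseq [a, b, c, d] w" for a b c d
    using assms(2) subseq_signed_perm(1)[OF assms(1) that]
    by (simp add: sts_spec_def eval_nat_numeral All_less_Suc2 conj_ac order.order_iff_strict)
  moreover have "(\<exists>a. subseq a w \<and> length a = length [x, y, z, t] \<and> sts_spec a [x, y, z, t]) \<longleftrightarrow>
    (\<exists>a b c d. subseq [a, b, c, d] w \<and> sts_spec [a, b, c, d] [x, y, z, t])"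
    by (auto simp: length_Suc_conv)
  ultimately show ?thesis unfolding contains_pattern_iff[OF assms(1)] by (simp cong: conj_cong)
qed

text \<open>The two patterns of length 2 are exactly the inversions between opposite signs. Once
  these are excluded, an occurrence of 2413 or 3142 in absolute values has constant sign and is one
  of the four signed patterns.\<close>

lemma separable_iff: "separable n w \<longleftrightarrow> w \<in> signed_perms n \<and> separable_word w"
proof (cases "w \<in> signed_perms n")
  case True
  have two: "{1..int 2} = {1, 2}" and four: "{1..int 4} = {1, 2, 3, 4}" by auto
  have sp: "[-2, 1] \<in> signed_perms 2" "[2, -1] \<in> signed_perms 2"
    "[3, 1, 4, 2] \<in> signed_perms 4" "[2, 4, 1, 3] \<in> signed_perms 4"
    "[-3, -1, -4, -2] \<in> signed_perms 4" "[-2, -4, -1, -3] \<in> signed_perms 4"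
    unfolding signed_perms_iff two four by auto
  note pat = sp(1,2)[THEN contains_pattern_2[OF True]] sp(3-)[THEN contains_pattern_4[OF True]]
  have "separable_word w" if sep: "separable n w"
  proof -
    have np: "\<not> contains_pattern w [-2, 1]" "\<not> contains_pattern w [2, -1]"
      using sep unfolding separable_def by simp_all
    have inv: "sgn a = sgn b" if s: "subseq [a, b] w" and less: "\<bar>b\<bar> < \<bar>a\<bar>" for a b
    proof -
      have "a \<noteq> 0" "b \<noteq> 0"
        using subseq_set_subset[OF s] signed_perms_nonzero[OF True] by auto
      moreover have "contains_pattern w [-2, 1]" if "a < 0" "0 < b"
        unfolding pat using that s less by (intro exI[of _ a] exI[of _ b] conjI) simp_all
      moreover have "contains_pattern w [2, -1]" if "0 < a" "b < 0"
        unfolding pat using that s less by (intro exI[of _ a] exI[of _ b] conjI) simp_all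
      ultimately show ?thesis
        using np by (cases a "0::int" rule: linorder_cases; cases b "0::int" rule: linorder_cases) auto
    qed
    have sgns: "sgn b = sgn a \<and> sgn c = sgn a \<and> sgn d = sgn a"
      if s: "subseq [a, b, c, d] w" and less: "\<bar>c\<bar> < \<bar>a\<bar> \<and> \<bar>a\<bar> < \<bar>d\<bar> \<and> \<bar>d\<bar> < \<bar>b\<bar> \<or>
        \<bar>b\<bar> < \<bar>d\<bar> \<and> \<bar>d\<bar> < \<bar>a\<bar> \<and> \<bar>a\<bar> < \<bar>c\<bar>" for a b c d
    proof -
      have "subseq [a, b] w" "subseq [a, c] w" "subseq [b, c] w" "subseq [a, d] w" "subseq [b, d] w"
        "subseq [c, d] w"
        by (rule subseq_order.trans[OF _ s], simp)+
      \<comment> \<open>The inverted pairs form the path \<open>a\<close>, \<open>c\<close>,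
        \<open>b\<close>, \<open>d\<close> in a 2413 and the path \<open>b\<close>,
        \<open>a\<close>, \<open>d\<close>, \<open>c\<close> in a 3142, so equality of signs spreads
        to all four entries.\<close>
      from less this[THEN inv] show ?thesis by (elim disjE conjE) (metis order.strict_trans)+
    qed
    have nz: "a \<noteq> 0" if "subseq [a, b, c, d] w" for a b c d
      using subseq_set_subset[OF that] signed_perms_nonzero[OF True] by auto
    have "avoids_2413 abs_less w"
      unfolding avoids_2413_def abs_less_def
    proof (intro allI impI notI)
      fix a b c d assume s: "subseq [a, b, c, d] w"
        and less: "\<bar>c\<bar> < \<bar>a\<bar> \<and> \<bar>a\<bar> < \<bar>d\<bar> \<and> \<bar>d\<bar> < \<bar>b\<bar>"
      have "sgn b = sgn a \<and> sgn c = sgn a \<and> sgn d = sgn a" using sgns s less by blast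
      then consider "0 < a \<and> 0 < b \<and> 0 < c \<and> 0 < d" | "a < 0 \<and> b < 0 \<and> c < 0 \<and> d < 0"
        using nz[OF s] by (auto simp: sgn_if split: if_splits)
      then show False
      proof cases
        case 1
        then have "contains_pattern w [2, 4, 1, 3]"
          unfolding pat using s less
          by (intro exI[of _ a] exI[of _ b] exI[of _ c] exI[of _ d] conjI) simp_all
        then show False using sep unfolding separable_def by blast
      next
        case 2
        then have "contains_pattern w [-2, -4, -1, -3]"
          unfolding pat using s less
          by (intro exI[of _ a] exI[of _ b] exI[of _ c] exI[of _ d] conjI) simp_all
        then show False using sep unfolding separable_def by blast
      qed
    qed
    moreover have "avoids_2413 abs_less\<inverse>\<inverse> w"
      unfolding avoids_2413_def abs_less_def conversep_iff
    proof (intro allI impI notI)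
      fix a b c d assume s: "subseq [a, b, c, d] w"
        and less: "\<bar>a\<bar> < \<bar>c\<bar> \<and> \<bar>d\<bar> < \<bar>a\<bar> \<and> \<bar>b\<bar> < \<bar>d\<bar>"
      have "sgn b = sgn a \<and> sgn c = sgn a \<and> sgn d = sgn a" using sgns s less by blast
      then consider "0 < a \<and> 0 < b \<and> 0 < c \<and> 0 < d" | "a < 0 \<and> b < 0 \<and> c < 0 \<and> d < 0"
        using nz[OF s] by (auto simp: sgn_if split: if_splits)
      then show False
      proof cases
        case 1
        then have "contains_pattern w [3, 1, 4, 2]"
          unfolding pat using s less
          by (intro exI[of _ a] exI[of _ b] exI[of _ c] exI[of _ d] conjI) simp_all
        then show False using sep unfolding separable_def by blast
      next
        case 2
        then have "contains_pattern w [-3, -1, -4, -2]"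
          unfolding pat using s less
          by (intro exI[of _ a] exI[of _ b] exI[of _ c] exI[of _ d] conjI) simp_all
        then show False using sep unfolding separable_def by blast
      qed
    qed
    ultimately show ?thesis using inv unfolding separable_word_def by blast
  qed
  moreover have "separable n w" if sep: "separable_word w"
  proof -
    have two: "\<bar>a\<bar> < \<bar>b\<bar> \<or> (a < 0 \<longleftrightarrow> b < 0)" if s: "subseq [a, b] w" for a b
    proof -
      have "\<bar>a\<bar> < \<bar>b\<bar> \<or> sgn a = sgn b"
        using sep s subseq_signed_perm(1)[OF True s] unfolding separable_word_def
        by (cases "\<bar>a\<bar>" "\<bar>b\<bar>" rule: linorder_cases) auto
      then show ?thesis by (metis sgn_less)
    qed
    \<comment> \<open>The first fact excludes 2413 and the second 3142. As disjunctions of strict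
      comparisons they clash directly with the comparisons that \<open>pat\<close> extracts from an
      occurrence.\<close>
    have four: "\<bar>a\<bar> < \<bar>c\<bar> \<or> \<bar>d\<bar> < \<bar>a\<bar> \<or> \<bar>b\<bar> < \<bar>d\<bar>" "\<bar>c\<bar> < \<bar>a\<bar> \<or> \<bar>a\<bar> < \<bar>d\<bar> \<or> \<bar>d\<bar> < \<bar>b\<bar>"
      if s: "subseq [a, b, c, d] w" for a b c d
    proof -
      have "\<not> (\<bar>c\<bar> < \<bar>a\<bar> \<and> \<bar>a\<bar> < \<bar>d\<bar> \<and> \<bar>d\<bar> < \<bar>b\<bar>)" "\<not> (\<bar>a\<bar> < \<bar>c\<bar> \<and> \<bar>d\<bar> < \<bar>a\<bar> \<and> \<bar>b\<bar> < \<bar>d\<bar>)"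
        using sep s unfolding separable_word_def avoids_2413_def abs_less_def conversep_iff
        by blast+
      moreover have "\<bar>a\<bar> \<noteq> \<bar>c\<bar>" "\<bar>a\<bar> \<noteq> \<bar>d\<bar>" "\<bar>b\<bar> \<noteq> \<bar>d\<bar>"
        using subseq_signed_perm(1)[OF True s] by auto
      ultimately show "\<bar>a\<bar> < \<bar>c\<bar> \<or> \<bar>d\<bar> < \<bar>a\<bar> \<or> \<bar>b\<bar> < \<bar>d\<bar>" "\<bar>c\<bar> < \<bar>a\<bar> \<or> \<bar>a\<bar> < \<bar>d\<bar> \<or> \<bar>d\<bar> < \<bar>b\<bar>"
        by linarith+
    qed
    have "\<not> contains_pattern w [-2, 1]" "\<not> contains_pattern w [2, -1]"
      unfolding pat by (intro notI; elim exE conjE; frule two; simp)+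
    moreover have "\<not> contains_pattern w [2, 4, 1, 3]" "\<not> contains_pattern w [-2, -4, -1, -3]"
      unfolding pat by (intro notI; elim exE conjE; frule four(1); simp)+
    moreover have "\<not> contains_pattern w [3, 1, 4, 2]" "\<not> contains_pattern w [-3, -1, -4, -2]"
      unfolding pat by (intro notI; elim exE conjE; frule four(2); simp)+
    ultimately show ?thesis using True unfolding separable_def by simp
  qed
  ultimately show ?thesis using True by blast
qed (simp add: separable_def)

lemma separable_word_subseq: "separable_word w \<Longrightarrow> subseq v w \<Longrightarrow> separable_word v"
  unfolding separable_word_def using avoids_2413_subseq subseq_order.trans by blast

lemma separable_word_map:
  assumes "separable_word xs"
    and "\<And>x. x \<in> set xs \<Longrightarrow> sgn (f x) = sgn x"
    and "\<And>x y. x \<in> set xs \<Longrightarrow> y \<in> set xs \<Longrightarrow> \<bar>f x\<bar> < \<bar>f y\<bar> \<longleftrightarrow> \<bar>x\<bar> < \<bar>y\<bar>"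
  shows "separable_word (map f xs)"
  unfolding separable_word_def
proof (intro conjI allI impI)
  fix a b assume "subseq [a, b] (map f xs)" and less: "\<bar>b\<bar> < \<bar>a\<bar>"
  then obtain zs where sub: "subseq zs xs" and zs: "[a, b] = map f zs"
    by (metis nths_map subseq_conv_nths)
  then obtain a' b' where z: "zs = [a', b']" "a = f a'" "b = f b'"
    by (auto simp: Cons_eq_map_conv eq_commute[of "map f zs"])
  moreover have "a' \<in> set xs" "b' \<in> set xs" using subseq_set_subset[OF sub] z by auto
  ultimately show "sgn a = sgn b"
    using assms sub less unfolding separable_word_def by metis
next
  show "avoids_2413 abs_less (map f xs)" "avoids_2413 abs_less\<inverse>\<inverse> (map f xs)"
    using assms(1,3) avoids_2413_map[of xs abs_less f abs_less]
      avoids_2413_map[of xs "abs_less\<inverse>\<inverse>" f "abs_less\<inverse>\<inverse>"]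
    unfolding separable_word_def by (simp_all add: abs_less_def)
qed

text \<open>In the first alternative no pair across the boundary is an inversion; in the second
  every such pair is one, and \<open>same_signs\<close> makes it harmless.\<close>

lemma separable_word_append:
  assumes "separable_word xs" "separable_word ys"
    and "(\<forall>x\<in>set xs. \<forall>y\<in>set ys. \<bar>x\<bar> < \<bar>y\<bar>) \<or>
         (\<forall>x\<in>set xs. \<forall>y\<in>set ys. \<bar>y\<bar> < \<bar>x\<bar>) \<and> same_signs xs ys"
  shows "separable_word (xs @ ys)"
  unfolding separable_word_def
proof (intro conjI allI impI)
  fix a b assume "subseq [a, b] (xs @ ys)" and less: "\<bar>b\<bar> < \<bar>a\<bar>"
  then consider "subseq [a, b] xs" | "a \<in> set xs" "b \<in> set ys" | "subseq [a, b] ys"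
    by (elim subseq_appendE) (auto simp: Cons_eq_append_conv subseq_singleton_left)
  then show "sgn a = sgn b"
    by cases (use assms less in \<open>fastforce simp: separable_word_def same_signs_def\<close>)+
next
  have "asymp abs_less\<inverse>\<inverse>" using abs_less_order(2) by simp
  then show "avoids_2413 abs_less (xs @ ys)" "avoids_2413 abs_less\<inverse>\<inverse> (xs @ ys)"
    using assms abs_less_order(2) unfolding separable_word_def
    by (auto intro!: avoids_2413_append simp: abs_less_def)
qed

subsection \<open>Sums of signed permutations\<close>

text \<open>Both sums move the entries of one operand away from 0. A negative \<open>k\<close> moves
  them back when a word is cut; the condition \<open>- k < \<bar>x\<bar>\<close> in the following
  lemmas keeps entries from reaching or crossing 0.\<close>

definition shift :: "int \<Rightarrow> int list \<Rightarrow> int list" where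
  "shift k = map (\<lambda>x. x + sgn x * k)"

lemma shift_simps [simp]: "length (shift k v) = length v" "shift k v = [] \<longleftrightarrow> v = []"
  by (simp_all add: shift_def)

lemma direct_sum_shift: "u \<oplus> v = u @ shift (int (length u)) v"
  by (simp add: direct_sum_def shift_def)

lemma skew_sum_shift: "u \<ominus> v = shift (int (length v)) u @ v"
  by (simp add: skew_sum_def shift_def)

lemma abs_add_sgn: "- k < \<bar>x\<bar> \<Longrightarrow> x \<noteq> 0 \<Longrightarrow> \<bar>x + sgn x * k\<bar> = \<bar>x\<bar> + k" for x k :: int
  by (cases x "0::int" rule: linorder_cases) auto

lemma sgn_add_sgn: "- k < \<bar>x\<bar> \<Longrightarrow> sgn (x + sgn x * k) = sgn x" for x k :: int
  by (cases x "0::int" rule: linorder_cases) auto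

lemma abs_set_shift:
  assumes "\<And>x. x \<in> set v \<Longrightarrow> - k < \<bar>x\<bar>" "0 \<notin> set v"
  shows "abs ` set (shift k v) = (\<lambda>y. y + k) ` abs ` set v"
  unfolding shift_def set_map image_image
  by (rule image_cong) (use assms in \<open>auto intro!: abs_add_sgn\<close>)

lemma separable_word_shift:
  assumes "separable_word v" "\<And>x. x \<in> set v \<Longrightarrow> - k < \<bar>x\<bar>" "0 \<notin> set v"
  shows "separable_word (shift k v)"
  unfolding shift_def
proof (rule separable_word_map[OF assms(1)])
  fix x assume "x \<in> set v"
  then show "sgn (x + sgn x * k) = sgn x" using assms(2) by (simp add: sgn_add_sgn)
next
  fix x y assume "x \<in> set v" "y \<in> set v"
  moreover from this have "x \<noteq> 0" "y \<noteq> 0" using assms(3) by auto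
  ultimately show "\<bar>x + sgn x * k\<bar> < \<bar>y + sgn y * k\<bar> \<longleftrightarrow> \<bar>x\<bar> < \<bar>y\<bar>"
    using assms(2) by (simp add: abs_add_sgn)
qed

lemma shift_uminus_shift:
  assumes "\<And>x. x \<in> set v \<Longrightarrow> k < \<bar>x\<bar>"
  shows "shift k (shift (- k) v) = v"
  unfolding shift_def map_map comp_def
proof (rule map_idI)
  fix x assume "x \<in> set v"
  then show "x + sgn x * - k + sgn (x + sgn x * - k) * k = x"
    using sgn_add_sgn[of "- k" x] assms by simp
qed

lemma signed_perms_bounds: "w \<in> signed_perms n \<Longrightarrow> x \<in> set w \<Longrightarrow> 1 \<le> \<bar>x\<bar> \<and> \<bar>x\<bar> \<le> int n"
  unfolding signed_perms_iff by auto

lemma image_add_Icc_int: "(\<lambda>y. y + k) ` {a..b} = {a + k..b + k}" for a b k :: int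
  by (metis image_add_atLeastAtMost' add.commute)

lemma separable_direct_sum:
  assumes "separable p u" "separable q v"
  shows "separable (p + q) (u \<oplus> v)"
proof -
  have u: "u \<in> signed_perms p" "separable_word u" and v: "v \<in> signed_perms q" "separable_word v"
    using assms by (auto simp: separable_iff)
  have len: "length u = p" using u(1) by (rule signed_perms_length)
  have pos: "- int p < \<bar>x\<bar>" if "x \<in> set v" for x :: int
    using signed_perms_bounds[OF v(1) that] by linarith
  have *: "abs ` set (shift (int p) v) = {int p + 1..int p + int q}"
    using v(1) signed_perms_nonzero[OF v(1)] pos
    by (simp add: abs_set_shift signed_perms_iff image_add_Icc_int add.commute)
  have "abs ` set (u \<oplus> v) = {1..int p} \<union> {int p + 1..int p + int q}"
    using u(1) len by (simp add: direct_sum_shift image_Un * signed_perms_iff)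
  also have "\<dots> = {1..int (p + q)}" by auto
  finally have "u \<oplus> v \<in> signed_perms (p + q)"
    using len v(1) by (simp add: signed_perms_iff direct_sum_shift)
  moreover have "\<bar>x\<bar> < \<bar>y\<bar>" if "x \<in> set u" "y \<in> set (shift (int p) v)" for x y
    using signed_perms_bounds[OF u(1) that(1)] imageI[OF that(2), of abs] * by auto
  then have "separable_word (u \<oplus> v)"
    unfolding direct_sum_shift len
    using u(2) v separable_word_shift[OF v(2)] signed_perms_nonzero[OF v(1)] pos
    by (intro separable_word_append) auto
  ultimately show ?thesis by (simp add: separable_iff)
qed

lemma same_signs_shift:
  assumes "same_signs u v" "0 \<le> k" "0 \<notin> set u"
  shows "same_signs (shift k u) v"
proof -
  have "sgn (x + sgn x * k) = sgn x" if "x \<in> set u" for x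
  proof -
    have "x \<noteq> 0" using that assms(3) by metis
    then show ?thesis using assms(2) by (intro sgn_add_sgn) linarith
  qed
  then show ?thesis using assms(1) unfolding same_signs_def shift_def set_map ball_simps by metis
qed

lemma separable_skew_sum:
  assumes "separable p u" "separable q v" "same_signs u v"
  shows "separable (p + q) (u \<ominus> v)"
proof -
  have u: "u \<in> signed_perms p" "separable_word u" and v: "v \<in> signed_perms q" "separable_word v"
    using assms by (auto simp: separable_iff)
  have len: "length v = q" using v(1) by (rule signed_perms_length)
  have pos: "- int q < \<bar>x\<bar>" if "x \<in> set u" for x :: int
    using signed_perms_bounds[OF u(1) that] by linarith
  have *: "abs ` set (shift (int q) u) = {int q + 1..int q + int p}"
    using u(1) signed_perms_nonzero[OF u(1)] pos
    by (simp add: abs_set_shift signed_perms_iff image_add_Icc_int add.commute)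
  have "abs ` set (u \<ominus> v) = {int q + 1..int q + int p} \<union> {1..int q}"
    using v(1) len by (simp add: skew_sum_shift image_Un * signed_perms_iff)
  also have "\<dots> = {1..int (p + q)}" by auto
  finally have "u \<ominus> v \<in> signed_perms (p + q)"
    using len u(1) by (simp add: signed_perms_iff skew_sum_shift)
  moreover have "\<bar>y\<bar> < \<bar>x\<bar>" if "x \<in> set (shift (int q) u)" "y \<in> set v" for x y
    using signed_perms_bounds[OF v(1) that(2)] imageI[OF that(1), of abs] * by auto
  moreover have "same_signs (shift (int q) u) v"
    using assms(3) signed_perms_nonzero[OF u(1)] by (intro same_signs_shift) auto
  ultimately have "separable_word (u \<ominus> v)"
    unfolding skew_sum_shift len
    using v(2) separable_word_shift[OF u(2)] signed_perms_nonzero[OF u(1)] pos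
    by (intro separable_word_append) auto
  with \<open>u \<ominus> v \<in> signed_perms (p + q)\<close> show ?thesis by (simp add: separable_iff)
qed

section \<open>Cuts of separable permutations as direct and skew sums\<close>

lemma initial_segment_int:
  fixes X Y :: "int set"
  assumes "X \<union> Y = {1..int n}" "\<And>x y. x \<in> X \<Longrightarrow> y \<in> Y \<Longrightarrow> x < y"
  shows "X = {1..int (card X)} \<and> Y = {int (card X) + 1..int n}"
proof -
  have fin: "finite X" using assms(1) by (metis finite_Un finite_atLeastAtMost_int)
  have "\<exists>m. 0 \<le> m \<and> m \<le> int n \<and> X = {1..m}"
  proof (cases "X = {}")
    case True
    then show ?thesis by (intro exI[of _ 0]) auto
  next
    case False
    have Max: "Max X \<in> X" using fin False by (rule Max_in)
    \<comment> \<open>A number of the range up to \<open>Max X\<close> cannot belong to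
      \<open>Y\<close>, whose elements all exceed \<open>Max X\<close>.\<close>
    have "X = {1..Max X}"
    proof (intro equalityI subsetI)
      fix x assume "x \<in> {1..Max X}"
      moreover have "Max X \<in> {1..int n}" using Max assms(1) by blast
      ultimately have "x \<in> X \<union> Y" unfolding assms(1) by auto
      then show "x \<in> X" using assms(2)[OF Max, of x] \<open>x \<in> {1..Max X}\<close> by auto
    next
      fix x assume "x \<in> X"
      then show "x \<in> {1..Max X}" using Max_ge[OF fin] assms(1) by auto
    qed
    moreover have "Max X \<in> {1..int n}" using Max assms(1) by blast
    ultimately show ?thesis by (intro exI[of _ "Max X"]) simp
  qed
  then obtain m where m: "0 \<le> m" "m \<le> int n" "X = {1..m}" by blast
  then have "int (card X) = m" by simp
  moreover have "Y = {m + 1..int n}"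
  proof (intro equalityI subsetI)
    fix y assume y: "y \<in> Y"
    then have "y \<in> {1..int n}" using assms(1) by blast
    moreover have "y \<notin> X" using assms(2) y by blast
    ultimately show "y \<in> {m + 1..int n}" using m(3) by auto
  next
    fix y assume y: "y \<in> {m + 1..int n}"
    then have "y \<in> X \<union> Y" unfolding assms(1) using m(1) by auto
    then show "y \<in> Y" using y m(3) by auto
  qed
  ultimately show ?thesis using m(3) by auto
qed

text \<open>Here \<open>as\<close> is the part with the smaller absolute values, on whichever side
  of the word it stands; \<open>separable_append_greater\<close> uses the lemma with the right part
  in this role.\<close>

lemma signed_perm_split:
  assumes "abs ` set as \<union> abs ` set bs = {1..int n}" "length as + length bs = n"
    and "distinct (map abs as)"
    and less: "\<And>a b. a \<in> set as \<Longrightarrow> b \<in> set bs \<Longrightarrow> \<bar>a\<bar> < \<bar>b\<bar>"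
  defines "p \<equiv> int (length as)"
  shows "as \<in> signed_perms (length as)" "shift (- p) bs \<in> signed_perms (length bs)"
    "\<And>b. b \<in> set bs \<Longrightarrow> p < \<bar>b\<bar>"
proof -
  have c: "card (abs ` set as) = length as" using distinct_card[OF assms(3)] by simp
  have *: "abs ` set as = {1..p}" "abs ` set bs = {p + 1..int n}"
    using initial_segment_int[OF assms(1)] less unfolding c p_def by auto
  show "as \<in> signed_perms (length as)" using * by (simp add: signed_perms_iff p_def)
  show gt: "p < \<bar>b\<bar>" if "b \<in> set bs" for b using *(2) imageI[OF that, of abs] by auto
  then have "0 \<notin> set bs" using p_def by force
  then have "abs ` set (shift (- p) bs) = {1..int n - p}"
    using gt abs_set_shift[of bs "- p"] *(2) image_add_Icc_int[of "- p" "p + 1" "int n"] by simp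
  then show "shift (- p) bs \<in> signed_perms (length bs)"
    using assms(2) by (auto simp: signed_perms_iff p_def)
qed

text \<open>Moving entries towards 0 without reaching it preserves signs and the order of absolute
  values, so a shift that is a signed permutation meets the specification of
  \<open>sts\<close>.\<close>

lemma sts_eq_shift:
  assumes "shift (- k) v \<in> signed_perms (length v)" "\<And>x. x \<in> set v \<Longrightarrow> k < \<bar>x\<bar>"
    and "distinct (map abs v)" "0 \<notin> set v"
  shows "sts v = shift (- k) v"
  unfolding sts_eq_iff[OF assms(3,4)] sts_spec_def
proof (intro conjI allI impI)
  have nth: "\<bar>shift (- k) v ! i\<bar> = \<bar>v ! i\<bar> - k" "sgn (shift (- k) v ! i) = sgn (v ! i)"
    if "i < length v" for i
  proof -
    have "v ! i \<in> set v" using that by simp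
    moreover from this have "v ! i \<noteq> 0" using assms(4) by metis
    ultimately show "\<bar>shift (- k) v ! i\<bar> = \<bar>v ! i\<bar> - k" "sgn (shift (- k) v ! i) = sgn (v ! i)"
      using assms(2) that abs_add_sgn[of "- k" "v ! i"] sgn_add_sgn[of "- k" "v ! i"]
      by (simp_all add: shift_def)
  qed
  show "shift (- k) v ! i < 0 \<longleftrightarrow> v ! i < 0" if "i < length v" for i
    using nth(2)[OF that] by (metis sgn_less)
  show "\<bar>shift (- k) v ! i\<bar> < \<bar>shift (- k) v ! j\<bar> \<longleftrightarrow> \<bar>v ! i\<bar> \<le> \<bar>v ! j\<bar>"
    if "j < length v" "i < j" for i j
    using nth(1)[of i] nth(1)[of j] that assms(3) by (auto simp: distinct_conv_nth order_le_less)
qed (rule assms(1))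

text \<open>The last equation puts the second summand in the form in which it enters a sign block
  decomposition.\<close>

lemma separable_append_less:
  assumes "separable n (as @ bs)" "\<And>a b. a \<in> set as \<Longrightarrow> b \<in> set bs \<Longrightarrow> \<bar>a\<bar> < \<bar>b\<bar>"
  defines "v \<equiv> shift (- int (length as)) bs"
  shows "separable (length as) as" "separable (length bs) v" "as @ bs = as \<oplus> v" "sts bs = v"
proof -
  have w: "as @ bs \<in> signed_perms n" and sep: "separable_word (as @ bs)"
    using assms(1) by (auto simp: separable_iff)
  have "abs ` set as \<union> abs ` set bs = {1..int n}" "length as + length bs = n"
    using w by (auto simp: signed_perms_iff image_Un)
  note split = signed_perm_split[OF this _ assms(2)]
  have "distinct (map abs as)" using signed_perms_distinct[OF w] by simp
  note split = split[OF this]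
  have "separable_word as" "separable_word bs" using sep by (auto elim: separable_word_subseq)
  then show "separable (length as) as" using split(1) by (simp add: separable_iff)
  have "separable_word v"
    unfolding v_def using \<open>separable_word bs\<close> split(3) signed_perms_nonzero[OF w]
    by (intro separable_word_shift) auto
  then show "separable (length bs) v" using split(2) by (simp add: separable_iff v_def)
  show "as @ bs = as \<oplus> v"
    using shift_uminus_shift[of bs "int (length as)"] split(3) by (simp add: direct_sum_shift v_def)
  show "sts bs = v"
    unfolding v_def using split(2,3) signed_perms_distinct[OF w] signed_perms_nonzero[OF w]
    by (intro sts_eq_shift) auto
qed

text \<open>Every pair across this cut is an inversion, so separability yields the equal signs that
  the skew sum requires.\<close>

lemma separable_append_greater:
  assumes "separable n (as @ bs)" "\<And>a b. a \<in> set as \<Longrightarrow> b \<in> set bs \<Longrightarrow> \<bar>b\<bar> < \<bar>a\<bar>"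
  defines "u \<equiv> shift (- int (length bs)) as"
  shows "separable (length as) u" "separable (length bs) bs" "same_signs u bs" "as @ bs = u \<ominus> bs"
proof -
  have w: "as @ bs \<in> signed_perms n" and sep: "separable_word (as @ bs)"
    using assms(1) by (auto simp: separable_iff)
  have "abs ` set bs \<union> abs ` set as = {1..int n}" "length bs + length as = n"
    using w by (auto simp: signed_perms_iff image_Un)
  note split = signed_perm_split[OF this _ assms(2)]
  have "distinct (map abs bs)" using signed_perms_distinct[OF w] by simp
  note split = split[OF this]
  have gt: "int (length bs) < \<bar>a\<bar>" if "a \<in> set as" for a
    using split(3) that by blast
  have "separable_word as" "separable_word bs" using sep by (auto elim: separable_word_subseq)
  then show "separable (length bs) bs" using split(1) by (simp add: separable_iff)
  have "separable_word u"
    unfolding u_def using \<open>separable_word as\<close> gt signed_perms_nonzero[OF w]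
    by (intro separable_word_shift) auto
  then show "separable (length as) u" using split(2) by (simp add: separable_iff u_def)
  have "sgn a = sgn b" if "a \<in> set as" "b \<in> set bs" for a b
  proof -
    have "subseq ([a] @ [b]) (as @ bs)"
      using that by (intro list_emb_append_mono) (simp_all add: subseq_singleton_left)
    then show ?thesis using sep assms(2)[OF that] unfolding separable_word_def by simp
  qed
  moreover have "sgn (a + sgn a * - int (length bs)) = sgn a" if "a \<in> set as" for a
    using gt[OF that] by (intro sgn_add_sgn) simp
  ultimately show "same_signs u bs" unfolding same_signs_def u_def shift_def by auto
  show "as @ bs = u \<ominus> bs"
    using shift_uminus_shift[of as "int (length bs)"] gt by (simp add: skew_sum_shift u_def)
qed

section \<open>Separable permutations as sums and generation from length 1\<close>

lemma separable_splits:
  assumes "separable n w" "2 \<le> n"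
  shows "\<exists>p\<in>{1..n - 1}. \<exists>u v. separable p u \<and> separable (n - p) v \<and>
           (w = u \<oplus> v \<or> same_signs u v \<and> w = u \<ominus> v)"
proof -
  have w: "w \<in> signed_perms n" "separable_word w" using assms(1) by (simp_all add: separable_iff)
  have dist: "distinct (map abs w)" using w(1) by (rule signed_perms_distinct)
  have "totalp_on (set w) abs_less"
    using dist unfolding distinct_map abs_less_def
    by (intro totalp_onI) (metis inj_onD linorder_neqE)
  then have "splits abs_less w \<or> splits abs_less\<inverse>\<inverse> w"
    using w assms(2) dist unfolding separable_word_def
    by (intro avoids_splits abs_less_order) (auto simp: distinct_map signed_perms_length)
  then show ?thesis
  proof
    assume "splits abs_less w"
    then obtain as bs where ab: "w = as @ bs" "as \<noteq> []" "bs \<noteq> []"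
      and less: "\<And>a b. a \<in> set as \<Longrightarrow> b \<in> set bs \<Longrightarrow> \<bar>a\<bar> < \<bar>b\<bar>"
      unfolding splits_def abs_less_def by blast
    have n: "n - length as = length bs" "length as \<in> {1..n - 1}"
      using ab signed_perms_length[OF w(1)] by (cases as; cases bs; auto)+
    from separable_append_less[OF assms(1)[unfolded ab(1)] less] show ?thesis
      using n ab(1) by metis
  next
    assume "splits abs_less\<inverse>\<inverse> w"
    then obtain as bs where ab: "w = as @ bs" "as \<noteq> []" "bs \<noteq> []"
      and less: "\<And>a b. a \<in> set as \<Longrightarrow> b \<in> set bs \<Longrightarrow> \<bar>b\<bar> < \<bar>a\<bar>"
      unfolding splits_def abs_less_def conversep_iff by blast
    have n: "n - length as = length bs" "length as \<in> {1..n - 1}"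
      using ab signed_perms_length[OF w(1)] by (cases as; cases bs; auto)+
    from separable_append_greater[OF assms(1)[unfolded ab(1)] less] show ?thesis
      using n ab(1) by metis
  qed
qed

lemma separable_singleton: "separable 1 [1]" "separable 1 [-1]"
proof -
  have "separable_word [x]" for x
    unfolding separable_word_def avoids_2413_def by (fastforce dest: list_emb_length)
  then show "separable 1 [1]" "separable 1 [-1]" by (auto simp: separable_iff signed_perms_iff)
qed

lemma separable_length: "separable n w \<Longrightarrow> length w = n"
  by (simp add: separable_iff signed_perms_length)

lemma sum_generated_imp_separable: "w \<in> sum_generated \<Longrightarrow> separable (length w) w"
proof (induction rule: sum_generated.induct)
  case (direct u v)
  then show ?case using separable_direct_sum[OF direct.IH] by (simp add: direct_sum_shift)
next
  case (skew u v)
  then show ?case using separable_skew_sum[OF skew.IH] by (simp add: skew_sum_shift)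
qed (use separable_singleton in auto)

lemma separable_imp_sum_generated: "separable n w \<Longrightarrow> 1 \<le> n \<Longrightarrow> w \<in> sum_generated"
proof (induction n arbitrary: w rule: less_induct)
  case (less n)
  show ?case
  proof (cases "n = 1")
    case True
    then obtain x where x: "w = [x]" "abs ` set w = {1}"
      using less.prems by (auto simp: separable_iff signed_perms_iff length_Suc_conv)
    then have "\<bar>x\<bar> = 1" by simp
    then have "w = [1] \<or> w = [-1]" using x(1) by auto
    then show ?thesis using sum_generated.one sum_generated.minus_one by auto
  next
    case False
    then obtain p u v where p: "1 \<le> p" "p \<le> n - 1" and uv: "separable p u" "separable (n - p) v"
      and w: "w = u \<oplus> v \<or> same_signs u v \<and> w = u \<ominus> v"
      using separable_splits[OF less.prems(1)] less.prems(2) by auto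
    have "u \<in> sum_generated" "v \<in> sum_generated"
      using less.IH[OF _ uv(1)] less.IH[OF _ uv(2)] p less.prems(2) False by auto
    then show ?thesis using w sum_generated.direct sum_generated.skew by blast
  qed
qed

subsection \<open>Sign blocks\<close>

text \<open>A member \<open>m\<close> is the number of entries before the change, so it serves
  directly as a cut point.\<close>

definition sign_changes :: "int list \<Rightarrow> nat set" where
  "sign_changes w = {m. 0 < m \<and> m < length w \<and> sgn (w ! (m - 1)) \<noteq> sgn (w ! m)}"

definition sign_cuts :: "int list \<Rightarrow> nat list" where
  "sign_cuts w = sorted_list_of_set (insert 0 (insert (length w) (sign_changes w)))"

lemma set_drop_take:
  assumes "b \<le> length w" shows "set (drop a (take b w)) = (!) w ` {a..<b}"
proof (intro equalityI subsetI)
  fix x assume "x \<in> set (drop a (take b w))"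
  then obtain i where "i < b - a" "x = w ! (a + i)"
    using assms by (auto simp: in_set_conv_nth)
  then show "x \<in> (!) w ` {a..<b}" by (intro image_eqI[of _ _ "a + i"]) auto
next
  fix x assume "x \<in> (!) w ` {a..<b}"
  then obtain m where "a \<le> m" "m < b" "x = w ! m" by auto
  then show "x \<in> set (drop a (take b w))"
    using assms by (auto simp: in_set_conv_nth intro!: exI[of _ "m - a"])
qed

lemma set_block: "p ! (i + 1) \<le> length w \<Longrightarrow> set (block w p i) = (!) w ` {p ! i..<p ! (i + 1)}"
  unfolding block_def by (rule set_drop_take)

lemma sorted_cuts:
  assumes "length p = k + 2" "\<forall>i\<le>k. p ! i < p ! (i + 1)"
  shows "sorted_wrt (<) (p :: nat list)"
  using assms by (subst sorted_wrt_iff_nth_Suc_transp) auto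

text \<open>By induction on \<open>k\<close>: either \<open>m\<close> is already below the last cut
  but one, or it lies in the last interval.\<close>

lemma ex_between_cuts:
  fixes p :: "nat \<Rightarrow> nat"
  assumes "p 0 \<le> m" "m < p (k + 1)"
  shows "\<exists>i\<le>k. p i \<le> m \<and> m < p (i + 1)"
  using assms
proof (induction k)
  case (Suc k)
  then show ?case by (cases "m < p (k + 1)") (auto intro: le_SucI)
qed auto

text \<open>An interior cut separates nonzero entries of opposite signs, so it is a sign change; a
  sign change that is not a cut would fall inside a block of constant sign. Thus the set of cuts is
  forced, and a strictly increasing list is determined by its set.\<close>

lemma sign_block_decomposition_unique:
  assumes "sign_block_decomposition n w p" and w: "w \<in> signed_perms n"
  shows "p = sign_cuts w"
proof -
  obtain k where len: "length p = k + 2" and p0: "p ! 0 = 0" and pn: "p ! (k + 1) = n"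
    and step: "\<forall>i\<le>k. p ! i < p ! (i + 1)"
    and same: "\<forall>i\<le>k. same_signs (block w p i) (block w p i)"
    and opp: "\<forall>i\<in>{1..k}. opposite_signs (block w p (i - 1)) (block w p i)"
    using assms(1) unfolding sign_block_decomposition_def by blast
  have lw: "length w = n" using w by (rule signed_perms_length)
  have sorted: "sorted_wrt (<) p" using len step by (rule sorted_cuts)
  have bound: "p ! i \<le> n" if "i \<le> k + 1" for i
    using sorted_wrt_nth_less[OF sorted, of i "k + 1"] that len pn by (cases "i = k + 1") auto
  have block: "w ! m \<in> set (block w p i)" if "i \<le> k" "p ! i \<le> m" "m < p ! (i + 1)" for i m
    using that bound[of "i + 1"] by (simp add: set_block lw)
  have "set p = insert 0 (insert n (sign_changes w))"
  proof (intro equalityI subsetI)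
    fix m assume "m \<in> set p"
    then obtain i where i: "i \<le> k + 1" "m = p ! i"
      using len by (metis in_set_conv_nth add_Suc_right less_Suc_eq_le numeral_2_eq_2 One_nat_def)
    consider "i = 0" | "i = k + 1" | "i \<in> {1..k}" using i(1) by fastforce
    then show "m \<in> insert 0 (insert n (sign_changes w))"
    proof cases
      case 3
      then have lt: "p ! (i - 1) < m" "m < p ! (i + 1)"
        using step[rule_format, of "i - 1"] step[rule_format, of i] i(2) by auto
      then have mem: "w ! (m - 1) \<in> set (block w p (i - 1))" "w ! m \<in> set (block w p i)"
        using block[of "i - 1" "m - 1"] block[of i m] 3 i(2) by auto
      have mn: "0 < m" "m < n" using lt bound[of "i + 1"] 3 by auto
      then have "w ! m \<noteq> 0" using signed_perms_nonzero[OF w] lw by (metis nth_mem)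
      moreover have "sgn (w ! (m - 1)) = - sgn (w ! m)"
        using opp 3 mem unfolding opposite_signs_def by blast
      ultimately have "sgn (w ! (m - 1)) \<noteq> sgn (w ! m)" by (auto simp: sgn_if)
      then show ?thesis using mn lw by (simp add: sign_changes_def)
    qed (use i p0 pn in auto)
  next
    fix m assume m: "m \<in> insert 0 (insert n (sign_changes w))"
    show "m \<in> set p"
    proof (rule ccontr)
      assume notin: "m \<notin> set p"
      have "0 \<in> set p" "n \<in> set p" using p0 pn len by (metis nth_mem add_2_eq_Suc' less_Suc_eq Suc_eq_plus1 zero_less_Suc)+
      then have m: "m \<in> sign_changes w" using m notin by auto
      then have "m < n" by (simp add: sign_changes_def lw)
      then obtain i where i: "i \<le> k" "p ! i \<le> m" "m < p ! (i + 1)"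
        using ex_between_cuts[of "(!) p" m k] p0 pn by auto
      \<comment> \<open>Since \<open>m\<close> is not the left end of its block, position
        \<open>m - 1\<close> lies in the same block.\<close>
      have "p ! i \<noteq> m" using notin i(1) len by (metis nth_mem add_2_eq_Suc' le_imp_less_Suc less_SucI)
      then have "w ! (m - 1) \<in> set (block w p i)" "w ! m \<in> set (block w p i)"
        using block[of i "m - 1"] block[of i m] i by auto
      then have "sgn (w ! (m - 1)) = sgn (w ! m)"
        using same i(1) unfolding same_signs_def by blast
      then show False using m by (simp add: sign_changes_def)
    qed
  qed
  moreover have "sorted_list_of_set (set p) = p"
    using sorted by (intro sorted_list_of_set.idem_if_sorted_distinct) (auto simp: strict_sorted_iff)
  ultimately show ?thesis unfolding sign_cuts_def lw by simp
qed

lemma separable_foldl: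
  assumes "separable p u" "\<And>v. v \<in> set vs \<Longrightarrow> \<exists>q. separable q v"
  shows "\<exists>q. separable q (foldl (\<oplus>) u vs)"
  using assms
proof (induction vs arbitrary: p u)
  case (Cons v vs)
  then obtain q where "separable q v" by force
  then have "separable (p + q) (u \<oplus> v)" using Cons.prems(1) separable_direct_sum by blast
  then show ?case using Cons by auto
qed auto

text \<open>Direct sums of separable pieces are separable of some size, and the length of
  \<open>w\<close> shows this size to be \<open>n\<close>.\<close>

lemma sign_block_decomposition_separable:
  assumes "sign_block_decomposition n w p" "w \<in> signed_perms n"
  shows "separable n w"
proof -
  obtain k where w: "w = foldl (\<oplus>) (block w p 0) (map (\<lambda>i. sts (block w p i)) [1..<k + 1])"
    and first: "separable (p ! 1) (block w p 0)"
    and rest: "\<forall>i\<in>{1..k}. separable (p ! (i + 1) - p ! i) (sts (block w p i))"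
    using assms(1) unfolding sign_block_decomposition_def by blast
  have "\<exists>q. separable q v" if "v \<in> set (map (\<lambda>i. sts (block w p i)) [1..<k + 1])" for v
    using that rest by fastforce
  then have "\<exists>q. separable q w"
    using separable_foldl[OF first] by (subst w) blast
  then obtain q where "separable q w" ..
  moreover from this have "q = n"
    using separable_length signed_perms_length[OF assms(2)] by blast
  ultimately show ?thesis by simp
qed

section \<open>Existence of the sign block decomposition\<close>

lemma separable_sign_less:
  assumes "separable n w" "i < j" "j < n" "sgn (w ! i) \<noteq> sgn (w ! j)"
  shows "\<bar>w ! i\<bar> < \<bar>w ! j\<bar>"
proof -
  have w: "w \<in> signed_perms n" "separable_word w" using assms(1) by (simp_all add: separable_iff)
  have lw: "length w = n" using w(1) by (rule signed_perms_length)
  have "w ! i \<in> set (take j w)" using assms(2,3) lw by (auto simp: in_set_conv_nth intro!: exI[of _ i])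
  moreover have "w ! j \<in> set (drop j w)" using assms(3) lw by (simp add: Cons_nth_drop_Suc[symmetric])
  ultimately have "subseq ([w ! i] @ [w ! j]) (take j w @ drop j w)"
    by (intro list_emb_append_mono) (simp_all add: subseq_singleton_left)
  then have sub: "subseq [w ! i, w ! j] w" by simp
  then have "\<not> \<bar>w ! j\<bar> < \<bar>w ! i\<bar>" using w(2) assms(4) unfolding separable_word_def by blast
  moreover have "\<bar>w ! i\<bar> \<noteq> \<bar>w ! j\<bar>" using subseq_signed_perm(1)[OF w(1) sub] by simp
  ultimately show ?thesis by simp
qed

text \<open>If the two entries have equal signs, one of the two entries at the sign change has the
  opposite sign and lies between them in absolute value.\<close>

lemma sign_change_less:
  assumes "separable n w" "m \<in> sign_changes w" "i < m" "m \<le> j" "j < n"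
  shows "\<bar>w ! i\<bar> < \<bar>w ! j\<bar>"
proof (cases "sgn (w ! i) = sgn (w ! j)")
  case True
  note less = separable_sign_less[OF assms(1)]
  have "sgn (w ! (m - 1)) \<noteq> sgn (w ! m)" using assms(2) by (simp add: sign_changes_def)
  then consider "sgn (w ! (m - 1)) \<noteq> sgn (w ! i)" | "sgn (w ! m) \<noteq> sgn (w ! i)" by metis
  then show ?thesis
  proof cases
    case 1
    then have "i \<noteq> m - 1" by auto
    then have "\<bar>w ! i\<bar> < \<bar>w ! (m - 1)\<bar>" using less[of i "m - 1"] assms 1 by auto
    also have "\<dots> < \<bar>w ! j\<bar>" using less[of "m - 1" j] assms 1 True by auto
    finally show ?thesis .
  next
    case 2
    then have "j \<noteq> m" using True by auto
    have "\<bar>w ! i\<bar> < \<bar>w ! m\<bar>" using less[of i m] assms 2 by auto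
    also have "\<dots> < \<bar>w ! j\<bar>" using less[of m j] assms 2 True \<open>j \<noteq> m\<close> by auto
    finally show ?thesis .
  qed
qed (use separable_sign_less[OF assms(1)] assms in auto)

text \<open>At a sign change everything before lies below everything after in absolute value. So the
  prefix up to each cut is the direct sum of the preceding prefix and the standardized block between
  them, and these sums accumulate to \<open>w\<close>.\<close>

lemma separable_sign_block_decomposition:
  assumes sep: "separable n w" and n: "1 \<le> n"
  shows "sign_block_decomposition n w (sign_cuts w)"
proof -
  define p where "p = sign_cuts w"
  define k where "k = length p - 2"
  have w: "w \<in> signed_perms n" using sep by (simp add: separable_iff)
  have lw: "length w = n" using w by (rule signed_perms_length)
  have nz: "w ! m \<noteq> 0" if "m < n" for m
    using that signed_perms_nonzero[OF w] lw nth_mem[of m w] by metis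
  have fin: "finite (sign_changes w)"
    by (rule finite_subset[of _ "{..<length w}"]) (auto simp: sign_changes_def)
  have setp: "set p = insert 0 (insert n (sign_changes w))"
    unfolding p_def sign_cuts_def lw
    by (rule sorted_list_of_set.set_sorted_key_list_of_set) (simp_all add: fin)
  have sorted: "sorted_wrt (<) p"
    unfolding p_def sign_cuts_def by (rule sorted_list_of_set.strict_sorted_key_list_of_set)
  have le: "m \<le> n" if "m \<in> set p" for m using that setp lw by (auto simp: sign_changes_def)
  \<comment> \<open>As 0 and \<open>n\<close> differ, \<open>p\<close> has at least two entries and
    the truncated subtraction defining \<open>k\<close> is exact.\<close>
  have "card {0, n} \<le> card (set p)" by (rule card_mono) (auto simp: setp fin)
  then have "card {0, n} \<le> length p" using card_length[of p] by linarith
  then have len: "length p = k + 2" using n by (simp add: k_def)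
  have mono: "p ! i < p ! j" if "i < j" "j \<le> k + 1" for i j
    using sorted_wrt_nth_less[OF sorted] that len by simp
  have mem: "p ! i \<in> set p" if "i \<le> k + 1" for i using that len by simp
  have idx: "\<exists>j\<le>k + 1. m = p ! j" if "m \<in> set p" for m
    using that len by (auto simp: in_set_conv_nth less_Suc_eq_le)
  have p0: "p ! 0 = 0"
  proof -
    obtain j where "j \<le> k + 1" "0 = p ! j" using idx[of 0] setp by auto
    then show ?thesis using mono[of 0 j] by (cases "j = 0") auto
  qed
  have pn: "p ! (k + 1) = n"
  proof -
    obtain j where j: "j \<le> k + 1" "n = p ! j" using idx[of n] setp by auto
    then show ?thesis using mono[of j "k + 1"] le[OF mem, of "k + 1"] by (cases "j = k + 1") auto
  qed
  have change: "p ! i \<in> sign_changes w" if "i \<in> {1..k}" for i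
    using mono[of 0 i] mono[of i "k + 1"] mem[of i] that p0 pn setp by auto
  \<comment> \<open>Such an \<open>m\<close> would itself be a cut, with an index strictly between
    \<open>i\<close> and \<open>i + 1\<close>.\<close>
  have no_change: "m \<notin> sign_changes w" if "i \<le> k" "p ! i < m" "m < p ! (i + 1)" for i m
  proof
    assume "m \<in> sign_changes w"
    then obtain j where j: "j \<le> k + 1" "m = p ! j" using idx setp by auto
    have "i < j" using mono[of j i] that j by (cases i j rule: linorder_cases) auto
    moreover have "j < i + 1" using mono[of "i + 1" j] that j by (cases "i + 1" j rule: linorder_cases) auto
    ultimately show False by simp
  qed
  have const: "sgn (w ! m) = sgn (w ! (p ! i))" if "i \<le> k" "p ! i \<le> m" "m < p ! (i + 1)" for i m
    using that(2,3)
  proof (induction m rule: dec_induct)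
    case (step m)
    have "Suc m < n" using step.prems le[OF mem, of "i + 1"] that(1) by simp
    moreover have "Suc m \<notin> sign_changes w" using no_change[of i "Suc m"] step that(1) by simp
    ultimately have "sgn (w ! m) = sgn (w ! Suc m)" by (simp add: sign_changes_def lw)
    then show ?case using step by simp
  qed simp
  have block: "set (block w p i) = (!) w ` {p ! i..<p ! (i + 1)}" if "i \<le> k" for i
    using le[OF mem, of "i + 1"] that by (simp add: set_block lw)
  have sgn_block: "sgn x = sgn (w ! (p ! i))" if i: "i \<le> k" and x: "x \<in> set (block w p i)" for i x
  proof -
    obtain m where "p ! i \<le> m" "m < p ! (i + 1)" "x = w ! m"
      using x block[OF i] by auto
    then show ?thesis using const[of i m] i by blast
  qed
  have same: "same_signs (block w p i) (block w p i)" if "i \<le> k" for i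
    unfolding same_signs_def using sgn_block[OF that] by metis
  have opp: "opposite_signs (block w p (i - 1)) (block w p i)" if i: "i \<in> {1..k}" for i
  proof -
    let ?m = "p ! i"
    have m: "0 < ?m" "?m < n" "sgn (w ! (?m - 1)) \<noteq> sgn (w ! ?m)"
      using change[OF i] by (auto simp: sign_changes_def lw)
    have "w ! ?m \<noteq> 0" "w ! (?m - 1) \<noteq> 0"
      using m(2) nz[of ?m] nz[of "?m - 1"] by auto
    then have "sgn (w ! (?m - 1)) = - sgn (w ! ?m)" using m(3) by (auto simp: sgn_if split: if_splits)
    moreover have "sgn (w ! (?m - 1)) = sgn (w ! (p ! (i - 1)))"
      using const[of "i - 1" "?m - 1"] mono[of "i - 1" i] i by auto
    ultimately show ?thesis
      unfolding opposite_signs_def using sgn_block[of i] sgn_block[of "i - 1"] i by fastforce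
  qed
  \<comment> \<open>For \<open>i = k + 1\<close> the cut point is \<open>n\<close> and no entry
    follows it; this case is included so that \<open>sep_take\<close> reaches the whole
    word.\<close>
  have cut: "\<bar>a\<bar> < \<bar>b\<bar>" if i: "i \<in> {1..k + 1}"
    and a: "a \<in> set (take (p ! i) w)" and b: "b \<in> set (drop (p ! i) w)" for i a b
  proof (cases "i = k + 1")
    case False
    then have "p ! i \<in> sign_changes w" using change i by simp
    moreover obtain j where "j < p ! i" "a = w ! j"
      using a by (auto simp: in_set_conv_nth)
    moreover obtain l where "l < n - p ! i" "b = w ! (p ! i + l)"
      using b lw by (auto simp: in_set_conv_nth)
    ultimately show ?thesis using sign_change_less[OF sep] by simp
  qed (use b pn lw in simp)
  have len_take: "length (take (p ! i) w) = p ! i" if "i \<le> k + 1" for i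
    using le[OF mem[OF that]] lw by simp
  have sep_take: "separable (p ! i) (take (p ! i) w)" if "i \<in> {1..k + 1}" for i
    using separable_append_less(1)[of n "take (p ! i) w" "drop (p ! i) w"] sep cut[OF that]
      len_take[of i] that by simp
  have block_app: "take (p ! (i + 1)) w = take (p ! i) w @ block w p i" if "i \<le> k" for i
  proof -
    have "take (p ! i) (take (p ! (i + 1)) w) = take (p ! i) w"
      using mono[of i "i + 1"] that by (simp add: min_def)
    then show ?thesis
      using append_take_drop_id[of "p ! i" "take (p ! (i + 1)) w"] unfolding block_def by simp
  qed
  have step: "separable (p ! (i + 1) - p ! i) (sts (block w p i)) \<and>
      take (p ! (i + 1)) w = take (p ! i) w \<oplus> sts (block w p i)" if i: "i \<in> {1..k}" for i
  proof -
    have "length (block w p i) = p ! (i + 1) - p ! i"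
      using len_take[of "i + 1"] i by (simp add: block_def)
    moreover have "set (block w p i) \<subseteq> set (drop (p ! i) w)"
      unfolding block_def by (simp add: drop_take set_take_subset)
    then have "\<bar>a\<bar> < \<bar>b\<bar>" if "a \<in> set (take (p ! i) w)" "b \<in> set (block w p i)" for a b
      using cut[of i a b] that i by auto
    \<comment> \<open>The cut is made in the prefix ending at the next cut point instead of in all
      of \<open>w\<close>, so that the second part is a single block.\<close>
    moreover have "separable (p ! (i + 1)) (take (p ! i) w @ block w p i)"
      using sep_take[of "i + 1"] block_app[of i] i by simp
    ultimately show ?thesis
      using separable_append_less(2-4)[of "p ! (i + 1)" "take (p ! i) w" "block w p i"]
        block_app[of i] i by auto
  qed
  have first: "block w p 0 = take (p ! 1) w" using p0 by (simp add: block_def)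
  have fold: "take (p ! (i + 1)) w =
      foldl (\<oplus>) (block w p 0) (map (\<lambda>i. sts (block w p i)) [1..<i + 1])" if "i \<le> k" for i
    using that
  proof (induction i)
    case (Suc i)
    then show ?case using step[of "Suc i"] by simp
  qed (simp add: first)
  have "w = take (p ! (k + 1)) w" using pn lw by simp
  also note fold[OF order_refl]
  finally have "w = foldl (\<oplus>) (block w p 0) (map (\<lambda>i. sts (block w p i)) [1..<k + 1])" .
  moreover have "\<forall>i\<le>k. p ! i < p ! (i + 1)" using mono by simp
  moreover have "separable (p ! 1) (block w p 0)" using sep_take[of 1] first by simp
  ultimately show ?thesis
    unfolding sign_block_decomposition_def p_def[symmetric]
    using len p0 pn step same opp by blast
qed

theorem theorem3p6:
  fixes n :: nat and w :: "int list"
  assumes "n \<ge> 1" and "w \<in> signed_perms n"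
  shows "(n \<ge> 2 \<longrightarrow>
            (separable n w \<longleftrightarrow>
             (\<exists>p\<in>{1..n - 1}. \<exists>u v. separable p u \<and> separable (n - p) v \<and>
                (w = u \<oplus> v \<or> (same_signs u v \<and> w = u \<ominus> v))))) \<and>
         (separable n w \<longleftrightarrow> (\<exists>!p. sign_block_decomposition n w p)) \<and>
         (separable n w \<longleftrightarrow> w \<in> sum_generated)"
proof (intro conjI impI)
  assume n2: "n \<ge> 2"
  have "separable n w" if p: "p \<in> {1..n - 1}" and "separable p u" "separable (n - p) v"
    "w = u \<oplus> v \<or> (same_signs u v \<and> w = u \<ominus> v)" for p u v
    using separable_direct_sum[of p u "n - p" v] separable_skew_sum[of p u "n - p" v] that by auto
  then show "separable n w \<longleftrightarrow> (\<exists>p\<in>{1..n - 1}. \<exists>u v. separable p u \<and> separable (n - p) v \<and>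
      (w = u \<oplus> v \<or> (same_signs u v \<and> w = u \<ominus> v)))"
    using separable_splits[of n w] n2 by blast
next
  show "separable n w \<longleftrightarrow> (\<exists>!p. sign_block_decomposition n w p)"
    using separable_sign_block_decomposition sign_block_decomposition_unique
      sign_block_decomposition_separable assms by metis
next
  show "separable n w \<longleftrightarrow> w \<in> sum_generated"
    using separable_imp_sum_generated sum_generated_imp_separable signed_perms_length assms by metis
qed

end
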